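(* Let $k$ be an algebraically closed field, $H$ a $k$-vector space of finite dimension $d$, $P^\bullet$ and $Q^\bullet$ complete flags in $H$, and $a_\bullet,b_\bullet\in\mathbb{Z}^{r+1}$ sequences with $0\le a_0<\dots<a_r<d$ and $0\le b_0<\dots<b_r<d$. Let $\Lambda\in\Sigma^\circ_{P^\bullet,a_\bullet}\cap\Sigma^\circ_{Q^\bullet,b_\bullet}$ be a $k$-point, and let $\sigma$ denote the permutation of $\{0,\dots,r\}$ associated to the complete flags $\Lambda\cap P^\bullet$ and $\Lambda\cap Q^\bullet$ in $\Lambda$. For $j\in\{0,\dots,r\}$, let $$\mu(j)=\max\{i\le j: i\text{ is active in }a_\bullet\},$$ setting $\mu(j)=0$ if no such $i$ exists, and set $m(j)=a_{\mu(j)}$. Similarly, let $$\nu(j)=\max\{i\le\sigma(j): i\text{ is active in }b_\bullet\},$$ setting $\nu(j)=0$ if no such $i$ exists, and set $n(j)=b_{\nu(j)}$. Then $$\dim T_\Lambda\bigl(\Sigma_{P^\bullet,a_\bullet}\cap\Sigma_{Q^\bullet,b_\bullet}\bigr)=\rho-1+\sum_{j=0}^r\operatorname{codim}_H\bigl(P^{m(j)}+Q^{n(j)}+\Lambda\bigr),$$ where $\rho-1=(r+1)(d-r-1)-\sum_{i=0}^r(a_i-i)-\sum_{i=0}^r(b_i-i)$.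
   Context: Complete flags are indexed by codimension: $0=P^d\subset\dots\subset P^1\subset P^0=H$ with $\operatorname{codim}P^i=i$. The Schubert variety $\Sigma_{P^\bullet,a_\bullet}$ is the closed subscheme of $\operatorname{Gr}(r+1,H)$ (the Grassmannian of $(r+1)$-dimensional subspaces) defined by the determinantal conditions $\dim(\Lambda\cap P^{a_i})\ge r+1-i$ for $i=0,\dots,r$ (i.e. $\Lambda\to H/P^{a_i}$ has rank at most $i$). The intersection $\Sigma_{P^\bullet,a_\bullet}\cap\Sigma_{Q^\bullet,b_\bullet}$ is scheme-theoretic, and $T_\Lambda$ denotes its Zariski tangent space. An index $i\in\{0,\dots,r\}$ is active in $a_\bullet$ if $i>0$ and $a_i>a_{i-1}+1$, or $i=0$ and $a_0>0$. $\Sigma^\circ_{P^\bullet,a_\bullet}$ is the open subscheme of $\Sigma_{P^\bullet,a_\bullet}$ of those $\Lambda$ with $\dim(\Lambda\cap P^{a_i})=r+1-i$ for every active index $i$ in $a_\bullet$. The same definitions apply to $(Q^\bullet,b_\bullet)$. For $\Lambda\in\operatorname{Gr}(r+1,H)$, the distinct subspaces among the $\Lambda\cap P^j$ form a complete flag of $\Lambda$, denoted $\Lambda\cap P^\bullet$; likewise for $\Lambda\cap Q^\bullet$. Permutation associated to two flags: given two complete flags $F^\bullet,G^\bullet$ (indexed by codimension) in an $(r+1)$-dimensional vector space $\Lambda$, there is a unique permutation $\sigma$ of $\{0,\dots,r\}$ such that there exists a basis $\lambda_0,\dots,\lambda_r$ of $\Lambda$ with $\lambda_i\in F^{i}\smallsetminus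 F^{i+1}$ and $\lambda_i\in G^{\sigma(i)}\smallsetminus G^{\sigma(i)+1}$ for all $i$. Here it is applied with $F^\bullet=\Lambda\cap P^\bullet$, $G^\bullet=\Lambda\cap Q^\bullet$. *)

theory Defs
  imports
    "HOL-Library.Poly_Mapping"
    "HOL-Library.Function_Algebras"
    "HOL-Computational_Algebra.Polynomial"
    "HOL-Combinatorics.Permutations"
    "HOL-Algebra.Ideal_Product"
    "Jordan_Normal_Form.Determinant"
begin

section \<open>Affine schemes and Zariski tangent spaces\<close>

text \<open>Polynomials over \<open>'k\<close> in variables indexed by \<open>'v\<close>; a monomial is a finitely supported
  exponent function.\<close>

type_synonym ('v, 'k) mv_poly = "('v \<Rightarrow>\<^sub>0 nat) \<Rightarrow>\<^sub>0 'k"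

definition poly_const :: "'k::comm_ring_1 \<Rightarrow> ('v, 'k) mv_poly"
  where "poly_const c = Poly_Mapping.single 0 c"

definition poly_var :: "'v \<Rightarrow> ('v, 'k::comm_ring_1) mv_poly"
  where "poly_var v = Poly_Mapping.single (Poly_Mapping.single v 1) 1"

definition poly_eval :: "('v \<Rightarrow> 'k) \<Rightarrow> ('v, 'k::comm_ring_1) mv_poly \<Rightarrow> 'k"
  where "poly_eval x f =
    (\<Sum>t\<in>Poly_Mapping.keys f. Poly_Mapping.lookup f t *
       (\<Prod>v\<in>Poly_Mapping.keys t. x v ^ Poly_Mapping.lookup t v))"

text \<open>The polynomial ring in the variables from \<open>V\<close>, the coordinate ring of affine space
  with coordinates indexed by \<open>V\<close>. The index type may be infinite, so the restriction to
  \<open>V\<close> is essential.\<close>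

definition poly_ring :: "'v set \<Rightarrow> ('v, 'k::comm_ring_1) mv_poly ring"
  where "poly_ring V =
    \<lparr> carrier = {f. \<forall>t\<in>Poly_Mapping.keys f. Poly_Mapping.keys t \<subseteq> V},
      monoid.mult = (*), one = 1, zero = 0, add = (+) \<rparr>"

definition point_ideal :: "'v set \<Rightarrow> ('v \<Rightarrow> 'k) \<Rightarrow> ('v, 'k::comm_ring_1) mv_poly set"
  where "point_ideal V x = {f \<in> carrier (poly_ring V). poly_eval x f = 0}"

text \<open>Let \<open>X\<close> be the closed subscheme of affine space cut out by the ideal \<open>I\<close> of
  \<open>R = poly_ring V\<close>, let \<open>x\<close> be a rational point of \<open>X\<close>, and let \<open>M\<close> be its maximal ideal in
  \<open>R\<close> (so \<open>I\<close> is contained in \<open>M\<close>). The maximal ideal \<open>N = M / I\<close> of the coordinate ring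
  \<open>R / I\<close> satisfies \<open>N / N^2 = M / (M^2 + I)\<close>, and this does not change on localizing at \<open>N\<close>.
  The Zariski tangent space is the dual of this vector space, i.e. the space of linear
  functionals on \<open>M\<close> that vanish on \<open>M^2\<close> and on \<open>I\<close>. A functional on \<open>M\<close> is represented by
  the total function extending it by 0 outside \<open>M\<close>.\<close>

definition zariski_tangent_space ::
    "'v set \<Rightarrow> ('v, 'k::field) mv_poly set \<Rightarrow> ('v \<Rightarrow> 'k) \<Rightarrow> (('v, 'k) mv_poly \<Rightarrow> 'k) set"
  where "zariski_tangent_space V I x =
    (let M = point_ideal V x in
      {l. (\<forall>f\<in>M. \<forall>g\<in>M. l (f + g) = l f + l g) \<and>
          (\<forall>c. \<forall>f\<in>M. l (poly_const c * f) = c * l f) \<and>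
          (\<forall>f\<in>ideal_prod (poly_ring V) M M. l f = 0) \<and>
          (\<forall>f\<in>I. l f = 0) \<and>
          (\<forall>f. f \<notin> M \<longrightarrow> l f = 0)})"

text \<open>Dimension of a space of \<open>'k\<close>-valued functions, with pointwise operations.\<close>

definition function_space_dim :: "('p \<Rightarrow> 'k::field) set \<Rightarrow> nat"
  where "function_space_dim = vector_space.dim (\<lambda>c l p. c * l p)"


section \<open>Flags and Schubert varieties\<close>

definition active :: "(nat \<Rightarrow> nat) \<Rightarrow> nat \<Rightarrow> bool"
  where "active a i \<longleftrightarrow> (i > 0 \<and> a i > a (i - 1) + 1) \<or> (i = 0 \<and> a 0 > 0)"

definition last_active :: "(nat \<Rightarrow> nat) \<Rightarrow> nat \<Rightarrow> nat"
  where "last_active a j = (if \<exists>i\<le>j. active a i then Max {i. i \<le> j \<and> active a i} else 0)"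

definition (in vector_space) codim :: "'b set \<Rightarrow> nat"
  where "codim W = dim UNIV - dim W"

definition (in vector_space) ordered_basis :: "nat \<Rightarrow> 'b set \<Rightarrow> (nat \<Rightarrow> 'b) \<Rightarrow> bool"
  where "ordered_basis n W e \<longleftrightarrow>
    inj_on e {..<n} \<and> independent (e ` {..<n}) \<and> span (e ` {..<n}) = W"

text \<open>Complete flags are indexed by codimension.\<close>

definition (in vector_space) complete_flag :: "nat \<Rightarrow> 'b set \<Rightarrow> (nat \<Rightarrow> 'b set) \<Rightarrow> bool"
  where "complete_flag n W F \<longleftrightarrow>
    F 0 = W \<and> (\<forall>i\<le>n. subspace (F i) \<and> dim (F i) = n - i) \<and> (\<forall>i<n. F (Suc i) \<subseteq> F i)"

text \<open>The flag in \<open>L\<close> formed by the distinct subspaces among the \<open>L \<inter> F j\<close>, reindexed by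
  codimension in \<open>L\<close>.\<close>

definition (in vector_space) induced_flag :: "'b set \<Rightarrow> (nat \<Rightarrow> 'b set) \<Rightarrow> nat \<Rightarrow> 'b set"
  where "induced_flag L F i =
    (THE W. W \<in> {L \<inter> F j |j. j \<le> dim UNIV} \<and> dim W + i = dim L)"

definition (in vector_space) flag_permutation ::
    "nat \<Rightarrow> 'b set \<Rightarrow> (nat \<Rightarrow> 'b set) \<Rightarrow> (nat \<Rightarrow> 'b set) \<Rightarrow> (nat \<Rightarrow> nat) \<Rightarrow> bool"
  where "flag_permutation n L F G \<sigma> \<longleftrightarrow>
    \<sigma> permutes {..<n} \<and>
    (\<exists>v. ordered_basis n L v \<and>
      (\<forall>i<n. v i \<in> F i - F (Suc i) \<and> v i \<in> G (\<sigma> i) - G (Suc (\<sigma> i))))"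

definition (in vector_space) grassmannian :: "nat \<Rightarrow> 'b set set"
  where "grassmannian n = {L. subspace L \<and> dim L = n}"

text \<open>The rational points of the Schubert variety and of its open part.\<close>

definition (in vector_space) schubert_points ::
    "nat \<Rightarrow> (nat \<Rightarrow> 'b set) \<Rightarrow> (nat \<Rightarrow> nat) \<Rightarrow> 'b set set"
  where "schubert_points r F a =
    {L \<in> grassmannian (r + 1). \<forall>i\<le>r. dim (L \<inter> F (a i)) \<ge> r + 1 - i}"

definition (in vector_space) open_schubert_points ::
    "nat \<Rightarrow> (nat \<Rightarrow> 'b set) \<Rightarrow> (nat \<Rightarrow> nat) \<Rightarrow> 'b set set"
  where "open_schubert_points r F a =
    {L \<in> schubert_points r F a. \<forall>i\<le>r. active a i \<longrightarrow> dim (L \<inter> F (a i)) = r + 1 - i}"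

text \<open>The standard atlas of the Grassmannian: an ordered basis \<open>e\<close> of the ambient space gives the
  open affine chart of those \<open>L\<close> that meet the span of \<open>e (r+1), \<dots>, e (d-1)\<close> trivially. It is an
  affine space: \<open>L\<close> has coordinates \<open>x\<close> when it is spanned by the vectors
  \<open>e s + (\<Sum>j. x (s, j) e (r+1+j))\<close> for \<open>s = 0, \<dots>, r\<close>.\<close>

definition chart_vars :: "nat \<Rightarrow> nat \<Rightarrow> (nat \<times> nat) set"
  where "chart_vars r d = {..r} \<times> {..<d - (r + 1)}"

definition (in vector_space) chart_point ::
    "nat \<Rightarrow> nat \<Rightarrow> (nat \<Rightarrow> 'b) \<Rightarrow> (nat \<times> nat \<Rightarrow> 'a) \<Rightarrow> 'b set"
  where "chart_point r d e x =
    span ((\<lambda>s. e s + (\<Sum>j<d - (r + 1). scale (x (s, j)) (e (r + 1 + j)))) ` {..r})"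

text \<open>The value of a linear functional \<open>\<psi>\<close>, extended linearly to the coordinate ring of the
  chart, on the basis vector \<open>e s + (\<Sum>j. X (s, j) e (r+1+j))\<close> of the universal subspace.\<close>

definition universal_entry ::
    "nat \<Rightarrow> nat \<Rightarrow> (nat \<Rightarrow> 'b) \<Rightarrow> ('b \<Rightarrow> 'k::comm_ring_1) \<Rightarrow> nat \<Rightarrow> (nat \<times> nat, 'k) mv_poly"
  where "universal_entry r d e \<psi> s =
    poly_const (\<psi> (e s)) +
    (\<Sum>j<d - (r + 1). poly_const (\<psi> (e (r + 1 + j))) * poly_var (s, j))"

text \<open>The minors of size \<open>i + 1\<close> of the map from the universal subspace to the quotient of the
  ambient space by \<open>F (a i)\<close>. Rows are given by functionals on this quotient, i.e. functionals
  vanishing on \<open>F (a i)\<close>; allowing arbitrary functionals instead of those of a dual basis only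
  adds linear combinations of minors, so the ideal is the usual determinantal ideal and no basis
  of the quotient has to be chosen.\<close>

definition (in vector_space) schubert_minors ::
    "nat \<Rightarrow> nat \<Rightarrow> (nat \<Rightarrow> 'b) \<Rightarrow> (nat \<Rightarrow> 'b set) \<Rightarrow> (nat \<Rightarrow> nat) \<Rightarrow> (nat \<times> nat, 'a) mv_poly set"
  where "schubert_minors r d e F a =
    {det (mat (i + 1) (i + 1) (\<lambda>(p, q). universal_entry r d e (\<psi> p) (c q))) |i \<psi> c.
       i \<le> r \<and>
       (\<forall>p\<le>i. Vector_Spaces.linear scale (*) (\<psi> p) \<and> (\<forall>v\<in>F (a i). \<psi> p v = 0)) \<and>
       (\<forall>q\<le>i. c q \<le> r)}"

text \<open>The ideal of the Schubert variety in the chart given by \<open>e\<close>.\<close>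

definition (in vector_space) schubert_ideal ::
    "nat \<Rightarrow> nat \<Rightarrow> (nat \<Rightarrow> 'b) \<Rightarrow> (nat \<Rightarrow> 'b set) \<Rightarrow> (nat \<Rightarrow> nat) \<Rightarrow> (nat \<times> nat, 'a) mv_poly set"
  where "schubert_ideal r d e F a = genideal (poly_ring (chart_vars r d)) (schubert_minors r d e F a)"

text \<open>The Zariski tangent space, at the point with coordinates \<open>x\<close>, of the scheme-theoretic
  intersection of two Schubert varieties, whose ideal is the sum of the two ideals.\<close>

definition (in vector_space) schubert_intersection_tangent_space ::
    "nat \<Rightarrow> nat \<Rightarrow> (nat \<Rightarrow> 'b) \<Rightarrow> (nat \<Rightarrow> 'b set) \<Rightarrow> (nat \<Rightarrow> nat) \<Rightarrow> (nat \<Rightarrow> 'b set) \<Rightarrow> (nat \<Rightarrow> nat)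
      \<Rightarrow> (nat \<times> nat \<Rightarrow> 'a) \<Rightarrow> ((nat \<times> nat, 'a) mv_poly \<Rightarrow> 'a) set"
  where "schubert_intersection_tangent_space r d e P a Q b x =
    zariski_tangent_space (chart_vars r d)
      (set_add (poly_ring (chart_vars r d)) (schubert_ideal r d e P a) (schubert_ideal r d e Q b)) x"

text \<open>The charts cover the Grassmannian.\<close>

lemma chart_exists:
  fixes scale :: "'a::field \<Rightarrow> 'b::ab_group_add \<Rightarrow> 'b"
  assumes fd: "finite_dimensional_vector_space scale B"
    and d: "vector_space.dim scale UNIV = d"
    and L: "L \<in> vector_space.grassmannian scale (r + 1)"
  shows "\<exists>e x. vector_space.ordered_basis scale d UNIV e \<and>
    L = vector_space.chart_point scale r d e x"
proof -
  interpret finite_dimensional_vector_space scale B by (fact fd)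
  have sL: "subspace L" and dL: "dim L = r + 1"
    using L by (auto simp: grassmannian_def)
  obtain A where A: "A \<subseteq> L" "independent A" "L \<subseteq> span A" "card A = dim L"
    using basis_exists by blast
  have finA: "finite A" using A(2) by (rule finiteI_independent)
  have spA: "span A = L" using A sL by (simp add: span_subspace)
  let ?E = "extend_basis A"
  have E: "independent ?E" "A \<subseteq> ?E" "span ?E = UNIV"
    using A(2) by (auto simp: independent_extend_basis extend_basis_superset span_extend_basis)
  have finE: "finite ?E" using E(1) by (rule finiteI_independent)
  have cE: "card ?E = d" using E d by (metis dim_span_eq_card_independent)
  have cD: "card (?E - A) = d - (r + 1)"
    using E(2) finA cE A(4) dL by (simp add: card_Diff_subset)
  have rd: "r + 1 \<le> d" using card_mono[OF finE E(2)] cE A(4) dL by simp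
  obtain f where f: "bij_betw f {..<r + 1} A"
    using ex_bij_betw_nat_finite[OF finA] A(4) dL by (auto simp: atLeast0LessThan)
  obtain g where g: "bij_betw g {..<d - (r + 1)} (?E - A)"
    using ex_bij_betw_nat_finite[of "?E - A"] finE cD by (auto simp: atLeast0LessThan)
  define e where "e i = (if i < r + 1 then f i else g (i - (r + 1)))" for i
  have i1: "e ` {..<r + 1} = A" using f by (force simp: e_def bij_betw_def)
  have "e ` {r + 1..<d} = g ` ((\<lambda>i. i - (r + 1)) ` {r + 1..<d})"
    by (auto simp: e_def image_image)
  also have "(\<lambda>i. i - (r + 1)) ` {r + 1..<d} = {..<d - (r + 1)}"
    by (force simp: image_iff intro!: bexI[of _ "_ + (r + 1)"])
  finally have i2: "e ` {r + 1..<d} = ?E - A" using g by (simp add: bij_betw_def)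
  have U: "{..<d} = {..<r + 1} \<union> {r + 1..<d}" using rd by auto
  have img: "e ` {..<d} = ?E" unfolding U image_Un i1 i2 using E(2) by auto
  have inj: "inj_on e {..<d}" using img cE by (intro eq_card_imp_inj_on) auto
  have "ordered_basis d UNIV e" using inj img E by (simp add: ordered_basis_def)
  moreover have "L = chart_point r d e (\<lambda>_. 0)"
  proof -
    have "{..r} = {..<r + 1}" by auto
    then show ?thesis using i1 spA by (simp add: chart_point_def)
  qed
  ultimately show ?thesis by blast
qed

end

theory Submission
  imports Defs
begin

text \<open>A tangent vector of the chart at \<open>L\<close> is a linear map \<open>\<phi>\<close> from \<open>L\<close> to a complement of \<open>L\<close>, i.e. to \<open>H / L\<close>.
  Evaluating a minor at the corresponding \<open>k[\<epsilon>]\<close>-valued point shows that \<open>\<phi>\<close> is tangent to the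
  \<open>i\<close>-th determinantal condition iff \<open>L \<rightarrow> H / P (a i)\<close> has rank less than \<open>i\<close> or \<open>\<phi>\<close> maps
  \<open>L \<inter> P (a i)\<close> into \<open>P (a i) + L\<close>. At a point of the open Schubert variety the conditions at inactive
  indices follow from those at active ones. In a basis of \<open>L\<close> adapted to both flags, the remaining
  conditions therefore constrain each basis vector separately: the \<open>j\<close>-th one has to be sent into
  \<open>(P (m j) + L) \<inter> (Q (n j) + L)\<close>, and the dimensions of these spaces modulo \<open>L\<close> add up.\<close>

section \<open>Tangent vectors as directional derivatives\<close>

text \<open>The coordinates \<open>y\<close> of a tangent vector form a matrix in the chart basis of
  \<open>L\<close>, whereas the conditions separate only in the basis \<open>v\<close> supplied by
  the flag permutation. Passing from \<open>y\<close> to a linear map \<open>\<phi>\<close> forgets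
  the basis. The two flags cut out two unrelated chains of subspaces of \<open>L\<close>; every
  member of either chain is spanned by some of the vectors of \<open>v\<close> (tails in the order
  of \<open>P\<close>, or tails after relabelling by \<open>\<sigma>\<close>), so no condition
  couples the images of several vectors. Origin of the constants: if
  \<open>i = last_active a j\<close>, then \<open>a i - i = a j - j\<close>, so
  \<open>P (m j) + L\<close> has dimension \<open>d + j - a j\<close> wherever the last active index
  is. The modular law turns the dimension of the intersection of two such spaces, taken modulo
  \<open>L\<close>, into the expected value
  \<open>d - r - 1 - (a j - j) - (b (\<sigma> j) - \<sigma> j)\<close> plus the codimension of their
  sum. The last sum of the theorem therefore measures the failure of transversality, vector by
  vector, and the expected values add up to \<open>\<rho> - 1\<close> because
  \<open>\<sigma>\<close> only permutes the terms with \<open>b\<close>.\<close>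

lemma carrier_poly_ring: "f \<in> carrier (poly_ring V) \<longleftrightarrow> (\<forall>t\<in>Poly_Mapping.keys f. Poly_Mapping.keys t \<subseteq> V)"
  by (simp add: poly_ring_def)

lemma poly_ring_simps [simp]:
  "monoid.mult (poly_ring V) = (*)" "one (poly_ring V) = 1" "zero (poly_ring V) = 0" "add (poly_ring V) = (+)"
  by (simp_all add: poly_ring_def)

lemma poly_ring_closed:
  assumes "f \<in> carrier (poly_ring V)" "g \<in> carrier (poly_ring V)"
  shows poly_ring_add: "f + g \<in> carrier (poly_ring V)"
    and poly_ring_mult: "f * g \<in> carrier (poly_ring V)"
    and poly_ring_diff: "f - g \<in> carrier (poly_ring V)"
proof -
  have *: "Poly_Mapping.keys (s + t) \<subseteq> V" if "Poly_Mapping.keys s \<subseteq> V" "Poly_Mapping.keys t \<subseteq> V"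
    for s t :: "'a \<Rightarrow>\<^sub>0 nat"
    using that keys_add[of s t] by blast
  have f: "\<And>t. t \<in> Poly_Mapping.keys f \<Longrightarrow> Poly_Mapping.keys t \<subseteq> V"
    and g: "\<And>t. t \<in> Poly_Mapping.keys g \<Longrightarrow> Poly_Mapping.keys t \<subseteq> V"
    using assms by (auto simp only: carrier_poly_ring)
  show "f + g \<in> carrier (poly_ring V)"
    unfolding carrier_poly_ring using f g keys_add[of f g] by (meson UnE subsetD)
  show "f * g \<in> carrier (poly_ring V)"
    unfolding carrier_poly_ring
  proof
    fix t assume "t \<in> Poly_Mapping.keys (f * g)"
    then obtain s s' where "t = s + s'" "s \<in> Poly_Mapping.keys f" "s' \<in> Poly_Mapping.keys g"
      using keys_mult[of f g] by auto
    then show "Poly_Mapping.keys t \<subseteq> V" using * f g by simp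
  qed
  show "f - g \<in> carrier (poly_ring V)"
    unfolding carrier_poly_ring using f g keys_diff[of f g] by (meson UnE subsetD)
qed

lemma poly_ring_uminus: "f \<in> carrier (poly_ring V) \<Longrightarrow> - f \<in> carrier (poly_ring V)"
  by (simp add: carrier_poly_ring)

lemma poly_const_in_poly_ring [simp]: "poly_const c \<in> carrier (poly_ring V)"
  by (simp add: carrier_poly_ring poly_const_def)

lemma poly_var_in_poly_ring: "v \<in> V \<Longrightarrow> poly_var v \<in> carrier (poly_ring V)"
  by (simp add: carrier_poly_ring poly_var_def)

lemma poly_const_0 [simp]: "poly_const 0 = 0"
  by (simp add: poly_const_def)

lemma poly_const_1: "poly_const 1 = 1"
  by (simp add: poly_const_def)

lemma poly_const_add: "poly_const (c + c') = poly_const c + poly_const c'"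
  by (simp add: poly_const_def single_add)

lemma poly_const_mult: "poly_const (c * c') = poly_const c * poly_const c'"
  by (simp add: poly_const_def mult_single)

lemma poly_ring_sum: "(\<And>i. i \<in> A \<Longrightarrow> f i \<in> carrier (poly_ring V)) \<Longrightarrow> sum f A \<in> carrier (poly_ring V)"
  by (induction A rule: infinite_finite_induct) (auto intro: poly_ring_add simp: carrier_poly_ring[of 0])

lemma cring_poly_ring: "cring (poly_ring V :: ('v, 'k::comm_ring_1) mv_poly ring)"
proof (rule cringI)
  show "abelian_group (poly_ring V :: ('v, 'k) mv_poly ring)"
  proof (rule abelian_groupI)
    fix f :: "('v, 'k) mv_poly" assume "f \<in> carrier (poly_ring V)"
    then show "\<exists>g\<in>carrier (poly_ring V). g \<oplus>\<^bsub>poly_ring V\<^esub> f = \<zero>\<^bsub>poly_ring V\<^esub>"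
      by (intro bexI[of _ "- f"] poly_ring_uminus) auto
  qed (auto simp: poly_ring_add algebra_simps carrier_poly_ring[of 0])
  show "Group.comm_monoid (poly_ring V :: ('v, 'k) mv_poly ring)"
    using poly_const_in_poly_ring[of 1 V]
    by (intro comm_monoidI) (auto simp: poly_ring_mult algebra_simps poly_const_1)
qed (auto simp: algebra_simps)

lemma poly_mapping_sum_single: "f = (\<Sum>t\<in>Poly_Mapping.keys f. Poly_Mapping.single t (Poly_Mapping.lookup f t))"
proof (rule poly_mapping_eqI)
  fix k
  have "Poly_Mapping.lookup (\<Sum>t\<in>Poly_Mapping.keys f. Poly_Mapping.single t (Poly_Mapping.lookup f t)) k
     = (\<Sum>t\<in>Poly_Mapping.keys f. if t = k then Poly_Mapping.lookup f t else 0)"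
    by (simp add: lookup_sum lookup_single when_def)
  also have "\<dots> = Poly_Mapping.lookup f k"
    by (simp add: not_in_keys_iff_lookup_eq_zero)
  finally show "Poly_Mapping.lookup f k = Poly_Mapping.lookup (\<Sum>t\<in>Poly_Mapping.keys f. Poly_Mapping.single t (Poly_Mapping.lookup f t)) k" by simp
qed

text \<open>Monomials with exponents supported in \<open>V\<close> are finite products of powers of
  variables, so constants and variables generate the ring. This reduces an identity between
  derivations to its values on variables.\<close>

lemma poly_ring_induct [consumes 1, case_names const var add mult]:
  fixes f :: "('v, 'k::comm_ring_1) mv_poly"
  assumes f: "f \<in> carrier (poly_ring V)"
    and C: "\<And>c. Q (poly_const c)"
    and X: "\<And>v. v \<in> V \<Longrightarrow> Q (poly_var v)"
    and A: "\<And>f g. f \<in> carrier (poly_ring V) \<Longrightarrow> g \<in> carrier (poly_ring V) \<Longrightarrow> Q f \<Longrightarrow> Q g \<Longrightarrow> Q (f + g)"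
    and M: "\<And>f g. f \<in> carrier (poly_ring V) \<Longrightarrow> g \<in> carrier (poly_ring V) \<Longrightarrow> Q f \<Longrightarrow> Q g \<Longrightarrow> Q (f * g)"
  shows "Q f"
proof -
  \<comment> \<open>Membership in the ring is carried along with \<open>Q\<close>, since the rules
    for sums and products ask for it.\<close>
  let ?G = "\<lambda>f. f \<in> carrier (poly_ring V) \<and> Q f"
  have GM: "?G (f * g)" if "?G f" "?G g" for f g using that M poly_ring_mult by blast
  have var: "?G (Poly_Mapping.single (Poly_Mapping.single v n) 1)" if "v \<in> V" for v n
  proof (induction n)
    case 0
    then show ?case using C[of 1] by (simp add: poly_const_1 carrier_poly_ring flip: single_one)
  next
    case (Suc n)
    have "Poly_Mapping.single (Poly_Mapping.single v (Suc n)) 1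
        = poly_var v * Poly_Mapping.single (Poly_Mapping.single v n) (1::'k)"
      by (simp add: poly_var_def mult_single flip: single_add)
    with GM[OF conjI[OF poly_var_in_poly_ring[OF that] X[OF that]] Suc] show ?case by simp
  qed
  have mon: "?G (Poly_Mapping.single t 1)" if "Poly_Mapping.keys t \<subseteq> V" for t
  proof -
    have "?G (Poly_Mapping.single (\<Sum>v\<in>A. Poly_Mapping.single v (Poly_Mapping.lookup t v)) 1)"
      if "finite A" "A \<subseteq> V" for A
      using that
    proof (induction A rule: finite_induct)
      case empty
      then show ?case using C[of 1] by (simp add: poly_const_1 carrier_poly_ring flip: single_one)
    next
      case (insert v A)
      have "Poly_Mapping.single (\<Sum>v\<in>insert v A. Poly_Mapping.single v (Poly_Mapping.lookup t v)) (1::'k)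
        = Poly_Mapping.single (Poly_Mapping.single v (Poly_Mapping.lookup t v)) 1
          * Poly_Mapping.single (\<Sum>v\<in>A. Poly_Mapping.single v (Poly_Mapping.lookup t v)) 1"
        using insert by (simp add: mult_single)
      with insert GM[OF var[of v "Poly_Mapping.lookup t v"]] show ?case by simp
    qed
    from this[OF finite_keys that] show ?thesis
      by (simp flip: poly_mapping_sum_single)
  qed
  have single: "?G (Poly_Mapping.single t c)" if "Poly_Mapping.keys t \<subseteq> V" for t c
  proof -
    have "Poly_Mapping.single t c = poly_const c * Poly_Mapping.single t 1"
      by (simp add: poly_const_def mult_single)
    with GM[OF conjI[OF poly_const_in_poly_ring C] mon[OF that]] show ?thesis by simp
  qed
  have "?G (\<Sum>t\<in>A. Poly_Mapping.single t (Poly_Mapping.lookup f t))"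
    if "finite A" "\<forall>t\<in>A. Poly_Mapping.keys t \<subseteq> V" for A
    using that
  proof (induction A rule: finite_induct)
    case empty
    then show ?case using C[of 0] by (simp add: carrier_poly_ring)
  next
    case (insert t A)
    then show ?case using single[of t] A by (simp add: poly_ring_add)
  qed
  from this[of "Poly_Mapping.keys f"] f show ?thesis
    unfolding carrier_poly_ring by (simp flip: poly_mapping_sum_single)
qed

text \<open>Evaluation at the \<open>k[\<epsilon>]\<close>-valued point \<open>x + \<epsilon> y\<close>.\<close>

definition dual_eval :: "('v \<Rightarrow> 'k) \<Rightarrow> ('v \<Rightarrow> 'k) \<Rightarrow> ('v, 'k::comm_ring_1) mv_poly \<Rightarrow> 'k poly"
  where "dual_eval x y f =
    (\<Sum>t\<in>Poly_Mapping.keys f. [:Poly_Mapping.lookup f t:] *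
       (\<Prod>v\<in>Poly_Mapping.keys t. [:x v, y v:] ^ Poly_Mapping.lookup t v))"

text \<open>The values of \<open>dual_eval\<close> are full polynomials in \<epsilon>, with no
  relation making \<epsilon>^2 zero. Coefficients 0 and 1 do not see higher powers, so coefficient 1
  is the derivative at \<open>x\<close> in direction \<open>y\<close>.\<close>

definition dir_deriv :: "('v \<Rightarrow> 'k) \<Rightarrow> ('v \<Rightarrow> 'k) \<Rightarrow> ('v, 'k::comm_ring_1) mv_poly \<Rightarrow> 'k"
  where "dir_deriv x y f = coeff (dual_eval x y f) 1"

lemma dual_eval_superset:
  assumes "finite A" "Poly_Mapping.keys f \<subseteq> A"
  shows "dual_eval x y f = (\<Sum>t\<in>A. [:Poly_Mapping.lookup f t:] *
       (\<Prod>v\<in>Poly_Mapping.keys t. [:x v, y v:] ^ Poly_Mapping.lookup t v))"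
  unfolding dual_eval_def
  by (rule sum.mono_neutral_left) (use assms in \<open>auto simp: in_keys_iff\<close>)

lemma dual_eval_0 [simp]: "dual_eval x y 0 = 0"
  by (simp add: dual_eval_def)

lemma dual_eval_add: "dual_eval x y (f + g) = dual_eval x y f + dual_eval x y g"
proof -
  let ?A = "Poly_Mapping.keys f \<union> Poly_Mapping.keys g"
  have "[:Poly_Mapping.lookup (f + g) t:] = [:Poly_Mapping.lookup f t:] + [:Poly_Mapping.lookup g t:]" for t
    by (simp add: lookup_add)
  then show ?thesis
    using keys_add[of f g] by (simp add: dual_eval_superset[of ?A] smult_add_left sum.distrib)
qed

lemma dual_eval_sum: "dual_eval x y (sum f A) = (\<Sum>i\<in>A. dual_eval x y (f i))"
  by (induction A rule: infinite_finite_induct) (auto simp: dual_eval_add)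

lemma dual_eval_single:
  "dual_eval x y (Poly_Mapping.single t c) =
    [:c:] * (\<Prod>v\<in>Poly_Mapping.keys t. [:x v, y v:] ^ Poly_Mapping.lookup t v)"
  by (simp add: dual_eval_def)

lemma prod_keys_superset:
  assumes "finite A" "Poly_Mapping.keys t \<subseteq> A"
  shows "(\<Prod>v\<in>Poly_Mapping.keys t. z v ^ Poly_Mapping.lookup t v) = (\<Prod>v\<in>A. z v ^ Poly_Mapping.lookup t v)"
  by (rule prod.mono_neutral_left) (use assms in \<open>auto simp: in_keys_iff\<close>)

lemma prod_keys_add:
  fixes s t :: "'v \<Rightarrow>\<^sub>0 nat" and z :: "'v \<Rightarrow> 'b::comm_monoid_mult"
  shows "(\<Prod>v\<in>Poly_Mapping.keys (s + t). z v ^ Poly_Mapping.lookup (s + t) v) =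
    (\<Prod>v\<in>Poly_Mapping.keys s. z v ^ Poly_Mapping.lookup s v) *
    (\<Prod>v\<in>Poly_Mapping.keys t. z v ^ Poly_Mapping.lookup t v)"
proof -
  let ?A = "Poly_Mapping.keys s \<union> Poly_Mapping.keys t"
  have fin: "finite ?A" by simp
  show ?thesis
    unfolding prod_keys_superset[OF fin keys_add] prod_keys_superset[OF fin Un_upper1]
      prod_keys_superset[OF fin Un_upper2]
    by (simp add: lookup_add power_add prod.distrib)
qed

lemma dual_eval_single_mult:
  "dual_eval x y (Poly_Mapping.single s c * Poly_Mapping.single t c') =
    dual_eval x y (Poly_Mapping.single s c) * dual_eval x y (Poly_Mapping.single t c')"
  unfolding mult_single dual_eval_single prod_keys_add by (simp add: mult_ac)

lemma dual_eval_mult: "dual_eval x y (f * g) = dual_eval x y f * dual_eval x y g"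
proof -
  let ?S = "\<lambda>f. \<Sum>t\<in>Poly_Mapping.keys f. Poly_Mapping.single t (Poly_Mapping.lookup f t)"
  have "dual_eval x y (?S f * ?S g) = dual_eval x y (?S f) * dual_eval x y (?S g)"
    by (simp only: sum_product dual_eval_sum dual_eval_single_mult)
  then show ?thesis by (simp flip: poly_mapping_sum_single)
qed

lemma dual_eval_const [simp]: "dual_eval x y (poly_const c) = [:c:]"
  by (simp add: poly_const_def dual_eval_single)

lemma dual_eval_var [simp]: "dual_eval x y (poly_var v) = [:x v, y v:]"
  by (simp add: poly_var_def dual_eval_single flip: one_pCons)

lemma dual_eval_hom: "comm_ring_hom (dual_eval x y)"
proof -
  have "dual_eval x y 1 = 1"
    using dual_eval_const[of x y 1] by (simp add: poly_const_1 one_pCons)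
  then show ?thesis by unfold_locales (simp_all add: dual_eval_add dual_eval_mult)
qed

text \<open>Setting \<epsilon> to 0 turns \<open>x + \<epsilon> y\<close> into \<open>x\<close>,
  whatever \<open>y\<close> is. The ring laws of \<open>poly_eval\<close> are thereby inherited from
  \<open>dual_eval\<close>.\<close>

lemma poly_eval_dual: "poly_eval x f = coeff (dual_eval x y f) 0"
  by (simp add: poly_eval_def dual_eval_def poly_sum poly_prod flip: poly_0_coeff_0)

lemma poly_eval_0 [simp]: "poly_eval x 0 = 0"
  and poly_eval_add: "poly_eval x (f + g) = poly_eval x f + poly_eval x g"
  and poly_eval_mult: "poly_eval x (f * g) = poly_eval x f * poly_eval x g"
  and poly_eval_const [simp]: "poly_eval x (poly_const c) = c"
  and poly_eval_var [simp]: "poly_eval x (poly_var v) = x v"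
  by (simp_all add: poly_eval_dual[of x _ x] dual_eval_add dual_eval_mult coeff_mult)

lemma dir_deriv_0 [simp]: "dir_deriv x y 0 = 0"
  and dir_deriv_add: "dir_deriv x y (f + g) = dir_deriv x y f + dir_deriv x y g"
  and dir_deriv_const [simp]: "dir_deriv x y (poly_const c) = 0"
  and dir_deriv_var [simp]: "dir_deriv x y (poly_var v) = y v"
  by (simp_all add: dir_deriv_def dual_eval_add)

lemma dir_deriv_mult:
  "dir_deriv x y (f * g) = poly_eval x f * dir_deriv x y g + poly_eval x g * dir_deriv x y f"
  by (simp add: dir_deriv_def poly_eval_dual[of x _ y] dual_eval_mult coeff_mult)

lemma poly_eval_uminus: "poly_eval x (- f) = - poly_eval x f"
  using poly_eval_add[of x f "- f"] by (simp add: eq_neg_iff_add_eq_0 add.commute)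

lemma dir_deriv_uminus: "dir_deriv x y (- f) = - dir_deriv x y f"
  using dir_deriv_add[of x y f "- f"] by (simp add: eq_neg_iff_add_eq_0 add.commute)

lemma poly_eval_diff: "poly_eval x (f - g) = poly_eval x f - poly_eval x g"
  using poly_eval_add[of x f "- g"] by (simp add: poly_eval_uminus)

lemma dir_deriv_diff: "dir_deriv x y (f - g) = dir_deriv x y f - dir_deriv x y g"
  using dir_deriv_add[of x y f "- g"] by (simp add: dir_deriv_uminus)

lemma point_idealI: "f \<in> carrier (poly_ring V) \<Longrightarrow> f - poly_const (poly_eval x f) \<in> point_ideal V x"
  by (simp add: point_ideal_def poly_ring_diff poly_eval_diff)

text \<open>By the product rule, if \<open>f\<close> has value and derivative 0 at \<open>x\<close>,
  so has every multiple of \<open>f\<close>. This is what allows tangency to be tested on generators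
  of an ideal.\<close>

lemma ideal_dir_deriv:
  "ideal {f \<in> point_ideal V x. dir_deriv x y f = 0} (poly_ring V :: ('v, 'k::comm_ring_1) mv_poly ring)"
    (is "ideal ?J ?R")
proof -
  interpret R: cring ?R by (rule cring_poly_ring)
  have minus: "\<ominus>\<^bsub>?R\<^esub> f = - f" if "f \<in> carrier ?R" for f
    using that by (intro R.minus_equality) (simp_all add: poly_ring_uminus)
  show ?thesis
  proof (rule idealI)
    show "subgroup ?J (add_monoid ?R)"
    proof
      fix f assume f: "f \<in> ?J"
      have "inv\<^bsub>add_monoid ?R\<^esub> f = - f"
        using minus[of f] f by (simp add: a_inv_def point_ideal_def)
      then show "inv\<^bsub>add_monoid ?R\<^esub> f \<in> ?J"
        using f by (simp add: point_ideal_def poly_ring_uminus poly_eval_uminus dir_deriv_uminus)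
    qed (auto simp: point_ideal_def poly_ring_add poly_eval_add dir_deriv_add carrier_poly_ring[of 0])
  qed (auto simp: point_ideal_def poly_ring_mult poly_eval_mult dir_deriv_mult R.ring_axioms)
qed

text \<open>The direction in which \<open>l\<close> differentiates, read off from the local
  parameters at \<open>x\<close>. The value 0 outside \<open>V\<close> makes this direction unique,
  as the index type may be larger than \<open>V\<close>.\<close>

definition tangent_coords :: "'v set \<Rightarrow> ('v \<Rightarrow> 'k) \<Rightarrow> (('v, 'k::comm_ring_1) mv_poly \<Rightarrow> 'k) \<Rightarrow> 'v \<Rightarrow> 'k"
  where "tangent_coords V x l v = (if v \<in> V then l (poly_var v - poly_const (x v)) else 0)"

text \<open>The reason is that \<open>f \<mapsto> l (f - f(x))\<close> is a derivation.\<close>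

lemma tangent_eq_dir_deriv:
  fixes x :: "'v \<Rightarrow> 'k::field"
  assumes l: "l \<in> zariski_tangent_space V I x" and f: "f \<in> point_ideal V x"
  shows "l f = dir_deriv x (tangent_coords V x l) f"
proof -
  let ?M = "point_ideal V x"
  have l_add: "\<And>f g. f \<in> ?M \<Longrightarrow> g \<in> ?M \<Longrightarrow> l (f + g) = l f + l g"
    and scale: "\<And>c f. f \<in> ?M \<Longrightarrow> l (poly_const c * f) = c * l f"
    and prod: "\<And>f. f \<in> ideal_prod (poly_ring V) ?M ?M \<Longrightarrow> l f = 0"
    using l unfolding zariski_tangent_space_def Let_def by blast+
  have M0: "0 \<in> ?M" by (simp add: point_ideal_def carrier_poly_ring)
  have l0: "l 0 = 0" using scale[OF M0, of 0] by simp
  have Mscale: "poly_const c * g \<in> ?M" if "g \<in> ?M" for c g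
    using that by (simp add: point_ideal_def poly_ring_mult poly_eval_mult)
  have Madd: "g + h \<in> ?M" if "g \<in> ?M" "h \<in> ?M" for g h
    using that by (simp add: point_ideal_def poly_ring_add poly_eval_add)
  have "l (f - poly_const (poly_eval x f)) = dir_deriv x (tangent_coords V x l) f"
    if "f \<in> carrier (poly_ring V)" for f
    using that
  proof (induction f rule: poly_ring_induct)
    case (const c)
    then show ?case by (simp add: l0)
  next
    case (var v)
    then show ?case by (simp add: tangent_coords_def)
  next
    case (add f g)
    have "f + g - poly_const (poly_eval x (f + g)) =
        (f - poly_const (poly_eval x f)) + (g - poly_const (poly_eval x g))"
      by (simp add: poly_eval_add poly_const_add)
    then show ?case
      using l_add[OF point_idealI point_idealI] add by (simp only: dir_deriv_add)
  next
    case (mult f g)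
    let ?f = "f - poly_const (poly_eval x f)" and ?g = "g - poly_const (poly_eval x g)"
    have M: "?f \<in> ?M" "?g \<in> ?M" using mult.hyps by (auto intro: point_idealI)
    \<comment> \<open>The product of the two differences lies in the square of the maximal ideal and
      is killed by \<open>l\<close>; what remains is the product rule.\<close>
    have "f * g - poly_const (poly_eval x (f * g)) =
        ?f * ?g + (poly_const (poly_eval x f) * ?g + poly_const (poly_eval x g) * ?f)"
      by (simp add: poly_eval_mult poly_const_mult algebra_simps)
    moreover have "?f * ?g \<in> ideal_prod (poly_ring V) ?M ?M"
      using ideal_prod.prod[OF M, of "poly_ring V"] by simp
    moreover have "?f * ?g \<in> ?M"
      using M by (simp add: point_ideal_def poly_ring_mult poly_eval_mult)
    ultimately show ?case
      using M mult.IH by (simp add: l_add scale prod Madd Mscale dir_deriv_mult)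
  qed
  from this[of f] f show ?thesis by (simp add: point_ideal_def)
qed

text \<open>A tangent functional is a directional derivative on the maximal ideal and 0 elsewhere,
  so its coordinates determine it. Conversely, a derivative that kills \<open>S\<close> and
  \<open>S'\<close> kills the ideals they generate by \<open>ideal_dir_deriv\<close>, and the square
  of the maximal ideal by the product rule.\<close>

lemma
  fixes x :: "'v \<Rightarrow> 'k::field" and S S' V
  defines "I \<equiv> set_add (poly_ring V) (genideal (poly_ring V) S) (genideal (poly_ring V) S')"
  assumes S: "S \<subseteq> point_ideal V x" and S': "S' \<subseteq> point_ideal V x"
  shows inj_on_tangent_coords: "inj_on (tangent_coords V x) (zariski_tangent_space V I x)"
    and tangent_coords_image: "tangent_coords V x ` zariski_tangent_space V I x =
      {y. (\<forall>v. v \<notin> V \<longrightarrow> y v = 0) \<and> (\<forall>f\<in>S \<union> S'. dir_deriv x y f = 0)}"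
proof -
  let ?R = "poly_ring V :: ('v, 'k) mv_poly ring" and ?M = "point_ideal V x"
  let ?T = "zariski_tangent_space V I x"
  interpret R: cring ?R by (rule cring_poly_ring)
  have out: "l f = 0" if "l \<in> ?T" "f \<notin> ?M" for l f
    using that unfolding zariski_tangent_space_def Let_def by blast
  show "inj_on (tangent_coords V x) ?T"
  proof (rule inj_onI)
    fix l l' assume *: "l \<in> ?T" "l' \<in> ?T" "tangent_coords V x l = tangent_coords V x l'"
    have "l f = l' f" for f
    proof (cases "f \<in> ?M")
      case True
      then show ?thesis using * by (metis tangent_eq_dir_deriv)
    next
      case False
      then show ?thesis using out[OF *(1)] out[OF *(2)] by simp
    qed
    then show "l = l'" by blast
  qed
  have SC: "S \<subseteq> carrier ?R" "S' \<subseteq> carrier ?R"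
    using S S' by (auto simp: point_ideal_def)
  have I: "I = {f + g |f g. f \<in> genideal ?R S \<and> g \<in> genideal ?R S'}"
    unfolding I_def set_add_def' by auto
  have zero: "0 \<in> genideal ?R A" for A
    unfolding genideal_def by (auto dest!: ideal.axioms(1) additive_subgroup.zero_closed)
  have SI: "S \<union> S' \<subseteq> I"
  proof
    fix f assume "f \<in> S \<union> S'"
    then have "f \<in> genideal ?R S \<or> f \<in> genideal ?R S'"
      using R.genideal_self[OF SC(1)] R.genideal_self[OF SC(2)] by blast
    then show "f \<in> I" unfolding I using zero[of S] zero[of S'] by force
  qed
  show "tangent_coords V x ` ?T = {y. (\<forall>v. v \<notin> V \<longrightarrow> y v = 0) \<and> (\<forall>f\<in>S \<union> S'. dir_deriv x y f = 0)}"
    (is "_ = ?Y")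
  proof (intro equalityI subsetI)
    fix y assume "y \<in> tangent_coords V x ` ?T"
    then obtain l where l: "l \<in> ?T" "y = tangent_coords V x l" by blast
    have "dir_deriv x y f = 0" if "f \<in> S \<union> S'" for f
    proof -
      have "l f = 0" using l(1) that SI unfolding zariski_tangent_space_def Let_def by blast
      moreover have "f \<in> ?M" using that S S' by blast
      ultimately show ?thesis using tangent_eq_dir_deriv[OF l(1)] l(2) by metis
    qed
    then show "y \<in> ?Y" using l(2) by (simp add: tangent_coords_def)
  next
    fix y assume y: "y \<in> ?Y"
    define l where "l f = (if f \<in> ?M then dir_deriv x y f else 0)" for f
    let ?J = "{f \<in> ?M. dir_deriv x y f = 0}"
    have J: "ideal ?J ?R" by (rule ideal_dir_deriv)
    have "genideal ?R S \<subseteq> ?J" "genideal ?R S' \<subseteq> ?J"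
      using y S S' by (intro R.genideal_minimal[OF J]; auto)+
    then have IJ: "I \<subseteq> ?J"
      unfolding I using additive_subgroup.a_closed[OF ideal.axioms(1)[OF J]] by fastforce
    have prod: "f \<in> ?J" if "f \<in> ideal_prod ?R ?M ?M" for f
      using that
    proof induction
      case (prod i j)
      then show ?case by (simp add: point_ideal_def poly_ring_mult poly_eval_mult dir_deriv_mult)
    next
      case (sum s1 s2)
      then show ?case using additive_subgroup.a_closed[OF ideal.axioms(1)[OF J]] by blast
    qed
    have "l \<in> ?T"
      unfolding zariski_tangent_space_def Let_def
    proof (intro CollectI conjI ballI allI impI)
      fix f g assume "f \<in> ?M" "g \<in> ?M"
      then show "l (f + g) = l f + l g"
        by (simp add: l_def point_ideal_def poly_ring_add poly_eval_add dir_deriv_add)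
    next
      fix c f assume "f \<in> ?M"
      then show "l (poly_const c * f) = c * l f"
        by (simp add: l_def point_ideal_def poly_ring_mult poly_eval_mult dir_deriv_mult)
    next
      fix f assume "f \<in> ideal_prod ?R ?M ?M"
      then show "l f = 0" using prod by (auto simp: l_def)
    next
      fix f assume "f \<in> I"
      then show "l f = 0" using IJ by (auto simp: l_def)
    qed (simp add: l_def)
    moreover have "y = tangent_coords V x l"
      using y by (auto simp: tangent_coords_def l_def point_ideal_def poly_ring_diff poly_var_in_poly_ring
        poly_eval_diff dir_deriv_diff)
    ultimately show "y \<in> tangent_coords V x ` ?T" by blast
  qed
qed

section \<open>Linear algebra\<close>

text \<open>Function spaces on infinite index types have infinite dimension, so a basis of
  \<open>S\<close> itself is transported along \<open>f\<close>.\<close>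

lemma (in vector_space_pair) dim_image_inj:
  assumes lf: "Vector_Spaces.linear s1 s2 f" and S: "vs1.subspace S" and inj: "inj_on f S"
  shows "vs2.dim (f ` S) = vs1.dim S"
proof -
  obtain A where A: "A \<subseteq> S" "vs1.independent A" "S \<subseteq> vs1.span A" "card A = vs1.dim S"
    using vs1.basis_exists by blast
  have sp: "vs1.span A = S" using A S by (simp add: vs1.span_subspace)
  have "vs2.independent (f ` A)"
    using linear_independent_injective_image[OF lf A(2)] inj sp by simp
  moreover have "vs2.span (f ` A) = f ` S" by (simp add: linear_span_image[OF lf] sp)
  ultimately have "vs2.dim (f ` S) = card (f ` A)" by (metis vs2.dim_span_eq_card_independent)
  also have "\<dots> = vs1.dim S"
    using A(1,4) inj by (metis card_image inj_on_subset)
  finally show ?thesis .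
qed

section \<open>Dimensions of function spaces\<close>

lemma vector_space_fun: "vector_space (\<lambda>c (l::'p \<Rightarrow> 'k::field) p. c * l p)"
  by unfold_locales (auto simp: fun_eq_iff algebra_simps)

lemma vector_space_self: "vector_space ((*) :: 'k::field \<Rightarrow> 'k \<Rightarrow> 'k)"
  by unfold_locales (auto simp: algebra_simps)

text \<open>The indicator functions \<open>\<delta> i\<close> of the points of \<open>I\<close> form
  a basis.\<close>

lemma function_space_dim_support:
  fixes I :: "'p set"
  assumes "finite I"
  shows "function_space_dim {g :: 'p \<Rightarrow> 'k::field. \<forall>p. p \<notin> I \<longrightarrow> g p = 0} = card I"
proof -
  interpret vector_space "\<lambda>c (l::'p \<Rightarrow> 'k) p. c * l p" by (rule vector_space_fun)
  define \<delta> where "\<delta> i p = (if p = i then 1 else 0 :: 'k)" for i p :: 'p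
  have inj: "inj_on \<delta> I"
    by (rule inj_onI) (metis \<delta>_def zero_neq_one)
  have sum: "(\<Sum>f\<in>\<delta> ` I. (\<lambda>p. c f * f p)) p = (if p \<in> I then c (\<delta> p) else 0)" for c and p
  proof -
    have "(\<Sum>f\<in>A. (\<lambda>p. c f * f p)) p = (\<Sum>f\<in>A. c f * f p)" for A
      by (induction A rule: infinite_finite_induct) simp_all
    then have "(\<Sum>f\<in>\<delta> ` I. (\<lambda>p. c f * f p)) p = (\<Sum>f\<in>\<delta> ` I. c f * f p)" .
    also have "\<dots> = (\<Sum>i\<in>I. c (\<delta> i) * \<delta> i p)"
      by (rule sum.reindex_cong[OF inj refl refl])
    also have "\<dots> = (if p \<in> I then c (\<delta> p) else 0)"
      using assms by (simp add: \<delta>_def if_distrib cong: if_cong)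
    finally show ?thesis .
  qed
  have indep: "independent (\<delta> ` I)"
  proof (rule independent_if_scalars_zero)
    fix c :: "('p \<Rightarrow> 'k) \<Rightarrow> 'k" and f
    assume 0: "(\<Sum>f\<in>\<delta> ` I. (\<lambda>p. c f * f p)) = 0" and "f \<in> \<delta> ` I"
    then obtain i where "i \<in> I" "f = \<delta> i" by blast
    then show "c f = 0" using sum[of c i] 0 by simp
  qed (use assms in simp)
  have "span (\<delta> ` I) = {g. \<forall>p. p \<notin> I \<longrightarrow> g p = 0}"
  proof (intro equalityI subsetI)
    fix g assume g: "g \<in> span (\<delta> ` I)"
    show "g \<in> {g. \<forall>p. p \<notin> I \<longrightarrow> g p = 0}"
      using g
    proof (induction rule: span_induct)
      case base
      show ?case by (auto simp: subspace_def)
    next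
      case (step f)
      then show ?case by (auto simp: \<delta>_def)
    qed
  next
    fix g :: "'p \<Rightarrow> 'k" assume g: "g \<in> {g. \<forall>p. p \<notin> I \<longrightarrow> g p = 0}"
    have "g = (\<Sum>f\<in>\<delta> ` I. (\<lambda>p. g (inv_into I \<delta> f) * f p))"
      using g inj by (auto simp: fun_eq_iff sum[of "\<lambda>f. g (inv_into I \<delta> f)"])
    also have "\<dots> \<in> span (\<delta> ` I)"
      by (intro span_sum span_scale span_base)
    finally show "g \<in> span (\<delta> ` I)" .
  qed
  then show ?thesis
    using dim_span_eq_card_independent[OF indep] inj by (simp add: function_space_dim_def card_image)
qed

lemma function_space_dim_image_inj:
  fixes F :: "('p \<Rightarrow> 'k::field) \<Rightarrow> ('q \<Rightarrow> 'k)"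
  assumes add: "\<And>g h. F (\<lambda>p. g p + h p) = (\<lambda>q. F g q + F h q)"
    and scale: "\<And>c g. F (\<lambda>p. c * g p) = (\<lambda>q. c * F g q)"
    and S: "module.subspace (\<lambda>c l p. c * l p) S" and inj: "inj_on F S"
  shows "function_space_dim (F ` S) = function_space_dim S"
proof -
  interpret vector_space_pair "\<lambda>c (l::'p \<Rightarrow> 'k) p. c * l p" "\<lambda>c (l::'q \<Rightarrow> 'k) q. c * l q"
    by (intro vector_space_pair.intro vector_space_fun)
  have "Vector_Spaces.linear (\<lambda>c (l::'p \<Rightarrow> 'k) p. c * l p) (\<lambda>c (l::'q \<Rightarrow> 'k) q. c * l q) F"
    unfolding Vector_Spaces.linear_iff using add scale by (auto simp: vector_space_fun plus_fun_def)
  from dim_image_inj[OF this S inj] show ?thesis by (simp add: function_space_dim_def)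
qed

section \<open>Determinants with one modified column\<close>

lemma det_combine_columns:
  fixes A :: "nat \<Rightarrow> nat \<Rightarrow> 'a::comm_ring_1"
  assumes "q0 < n"
  shows "det (mat n n (\<lambda>(p, q). if q = q0 then \<Sum>k<n. A p k * \<alpha> k else A p q)) =
    \<alpha> q0 * det (mat n n (\<lambda>(p, q). A p q))"
proof -
  let ?A = "mat n n (\<lambda>(p, q). A p q)"
  \<comment> \<open>The new column is the product of the matrix with the vector
    \<open>\<alpha>\<close>, which is the situation of Cramer's rule.\<close>
  have "replace_col ?A (?A *\<^sub>v vec n \<alpha>) q0 = mat n n (\<lambda>(p, q). if q = q0 then \<Sum>k<n. A p k * \<alpha> k else A p q)"
    by (rule eq_matI) (auto simp: replace_col_def scalar_prod_def atLeast0LessThan)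
  then show ?thesis
    using cramer_lemma_mat[of ?A n "vec n \<alpha>" q0] assms by simp
qed

lemma det_scale_column:
  fixes A :: "nat \<Rightarrow> nat \<Rightarrow> 'a::comm_ring_1"
  assumes "q0 < n"
  shows "det (mat n n (\<lambda>(p, q). if q = q0 then c * b p else A p q)) =
    c * det (mat n n (\<lambda>(p, q). if q = q0 then b p else A p q))"
proof -
  let ?B = "\<lambda>c. mat n n (\<lambda>(p, q). if q = q0 then c * b p else A p q)"
  have "transpose_mat (?B c) = multrow q0 c (transpose_mat (?B 1))"
    by (rule eq_matI) (use assms in auto)
  then have "det (transpose_mat (?B c)) = c * det (transpose_mat (?B 1))"
    using det_multrow[OF assms, of "transpose_mat (?B 1)" c] by simp
  then show ?thesis unfolding det_transpose[OF mat_carrier] mult_1 .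
qed

text \<open>The first-order term of a determinant over \<open>k[\<epsilon>]\<close> whose constant term is singular:
  a combination of the columns with vanishing constant term replaces the column \<open>q0\<close>, and
  \<open>\<epsilon>\<close> is taken out of it.\<close>

lemma coeff_1_det_singular:
  fixes A B :: "nat \<Rightarrow> nat \<Rightarrow> 'k::field"
  assumes q0: "q0 < n" and "\<And>p. p < n \<Longrightarrow> (\<Sum>q<n. A p q * \<alpha> q) = 0"
  shows "\<alpha> q0 * coeff (det (mat n n (\<lambda>(p, q). [:A p q, B p q:]))) 1 =
    det (mat n n (\<lambda>(p, q). if q = q0 then \<Sum>k<n. B p k * \<alpha> k else A p q))"
proof -
  let ?M = "mat n n (\<lambda>(p, q). [:A p q, B p q:])"
  let ?b = "\<lambda>p. \<Sum>k<n. B p k * \<alpha> k"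
  let ?N = "mat n n (\<lambda>(p, q). if q = q0 then [:?b p:] else [:A p q, B p q:])"
  have sum: "(\<Sum>k<n. [:A p k, B p k:] * [:\<alpha> k:]) = [:0, 1:] * [:?b p:]" if "p < n" for p
  proof -
    have "(\<Sum>k<n. [:A p k, B p k:] * [:\<alpha> k:]) = [:\<Sum>k<n. A p k * \<alpha> k, ?b p:]"
      by (induction n) (simp_all add: mult.commute)
    then show ?thesis using assms(2)[OF that] by simp
  qed
  have "[:\<alpha> q0:] * det ?M =
      det (mat n n (\<lambda>(p, q). if q = q0 then \<Sum>k<n. [:A p k, B p k:] * [:\<alpha> k:] else [:A p q, B p q:]))"
    by (rule det_combine_columns[OF q0, symmetric])
  also have "\<dots> = det (mat n n (\<lambda>(p, q). if q = q0 then [:0, 1:] * [:?b p:] else [:A p q, B p q:]))"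
    by (intro arg_cong[of _ _ det] eq_matI) (use sum in auto)
  also have "\<dots> = [:0, 1:] * det ?N"
    by (rule det_scale_column[OF q0])
  \<comment> \<open>The factor \<epsilon> on the right shifts the constant term of
    \<open>det ?N\<close> into degree 1, and this constant term is the determinant of the constant
    terms of the entries.\<close>
  finally have "coeff ([:\<alpha> q0:] * det ?M) 1 = coeff ([:0, 1:] * det ?N) 1" by simp
  then have "\<alpha> q0 * coeff (det ?M) 1 = poly (det ?N) 0"
    by (simp add: poly_0_coeff_0)
  also interpret comm_ring_hom "\<lambda>p. poly p (0::'k)" by unfold_locales auto
  have "poly (det ?N) 0 = det (map_mat (\<lambda>p. poly p 0) ?N)" by (rule hom_det[symmetric])
  also have "map_mat (\<lambda>p. poly p 0) ?N = mat n n (\<lambda>(p, q). if q = q0 then ?b p else A p q)"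
    by (rule eq_matI) auto
  finally show ?thesis .
qed

section \<open>Linear dependence modulo a subspace\<close>

context vector_space begin

lemma mem_span_Un_image:
  fixes n :: nat
  assumes "subspace K" and "x \<in> span (K \<union> v ` {..<n})"
  shows "\<exists>\<beta>. x - (\<Sum>q<n. scale (\<beta> q) (v q)) \<in> K"
  using assms(2)
proof (induction n arbitrary: x)
  case 0
  then show ?case using assms(1) by (metis Un_empty_right image_empty lessThan_0 span_eq_iff sum.empty diff_zero)
next
  case (Suc n)
  have "K \<union> v ` {..<Suc n} = insert (v n) (K \<union> v ` {..<n})" by (simp add: lessThan_Suc)
  with Suc.prems have "x \<in> span (insert (v n) (K \<union> v ` {..<n}))" by simp
  then obtain k where "x - scale k (v n) \<in> span (K \<union> v ` {..<n})"
    using span_breakdown_eq by blast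
  from Suc.IH[OF this] obtain \<beta> where \<beta>: "x - scale k (v n) - (\<Sum>q<n. scale (\<beta> q) (v q)) \<in> K" by blast
  have "(\<Sum>q<Suc n. scale ((\<beta>(n := k)) q) (v q)) = (\<Sum>q<n. scale (\<beta> q) (v q)) + scale k (v n)"
    by simp
  then show ?case using \<beta> by (metis diff_diff_eq add.commute)
qed

lemma exists_functional:
  assumes "x \<notin> span S"
  shows "\<exists>\<psi>. Vector_Spaces.linear scale (*) \<psi> \<and> \<psi> x = 1 \<and> (\<forall>y\<in>span S. \<psi> y = 0)"
proof -
  interpret pair: vector_space_pair scale "(*) :: 'a \<Rightarrow> 'a \<Rightarrow> 'a"
    by (intro vector_space_pair.intro vector_space_self vector_space_axioms)
  obtain A where A: "A \<subseteq> span S" "independent A" "span S \<subseteq> span A"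
    using maximal_independent_subset by blast
  have sp: "span A = span S" using A by (metis span_eq span_superset subset_antisym span_mono span_span)
  have "independent (insert x A)" using A(2) assms sp by (metis independent_insertI)
  from pair.linear_independent_extend[OF this, of "\<lambda>y. if y = x then 1 else 0"]
  obtain \<psi> where \<psi>: "Vector_Spaces.linear scale (*) \<psi>" "\<forall>y\<in>insert x A. \<psi> y = (if y = x then 1 else 0)"
    by auto
  have "\<psi> y = 0" if "y \<in> span A" for y
    by (rule pair.linear_eq_0_on_span[OF \<psi>(1) _ that]) (use \<psi>(2) assms A(1) in auto)
  then show ?thesis using \<psi> sp by auto
qed

text \<open>Choose \<open>\<psi> p\<close> to vanish on \<open>K\<close> and on the vectors before
  \<open>v p\<close>, with value 1 at \<open>v p\<close>. The matrix is then upper triangular with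
  diagonal 1.\<close>

lemma det_functionals:
  assumes v: "\<And>q. q < n \<Longrightarrow> v q \<notin> span (K \<union> v ` {..<q})"
  shows "\<exists>\<psi>. (\<forall>p<n. Vector_Spaces.linear scale (*) (\<psi> p) \<and> (\<forall>y\<in>K. \<psi> p y = 0)) \<and>
    det (mat n n (\<lambda>(p, q). \<psi> p (v q))) = 1"
proof -
  have "\<forall>p. \<exists>\<psi>. p < n \<longrightarrow> Vector_Spaces.linear scale (*) \<psi> \<and> \<psi> (v p) = 1 \<and> (\<forall>y\<in>span (K \<union> v ` {..<p}). \<psi> y = 0)"
    using exists_functional[OF v] by blast
  from choice[OF this] obtain \<psi> where \<psi>: "\<And>p. p < n \<Longrightarrow> Vector_Spaces.linear scale (*) (\<psi> p)" "\<And>p. p < n \<Longrightarrow> \<psi> p (v p) = 1"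
      "\<And>p y. p < n \<Longrightarrow> y \<in> span (K \<union> v ` {..<p}) \<Longrightarrow> \<psi> p y = 0"
    by blast
  let ?M = "mat n n (\<lambda>(p, q). \<psi> p (v q))"
  have "upper_triangular ?M"
    using \<psi>(3) by (simp add: upper_triangular_def span_base)
  then have "det ?M = prod_list (diag_mat ?M)" by (rule det_upper_triangular[OF _ mat_carrier])
  also have "diag_mat ?M = map (\<lambda>_. 1) [0..<n]" using \<psi>(2) by (simp add: diag_mat_def)
  also have "prod_list \<dots> = 1" by (induction n) auto
  finally show ?thesis using \<psi>(1,3) by (blast intro: span_base)
qed

end

context finite_dimensional_vector_space begin

text \<open>The modular law: \<open>dim\<close> of a set is the dimension of its span, so a union of
  subspaces stands for their sum here and below.\<close>

lemma dim_Un_Int: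
  assumes "subspace S" "subspace T"
  shows "dim (S \<union> T) + dim (S \<inter> T) = dim S + dim T"
proof -
  have "span (S \<union> T) = {x + y |x y. x \<in> S \<and> y \<in> T}"
    using assms by (simp add: span_Un span_eq_iff[THEN iffD2])
  then show ?thesis using dim_sums_Int[OF assms] by (metis dim_span)
qed

lemma dim_Un_image:
  assumes "\<And>q. q < n \<Longrightarrow> v q \<notin> span (K \<union> v ` {..<q})"
  shows "dim (K \<union> v ` {..<n}) = dim K + n"
  using assms
proof (induction n)
  case (Suc n)
  have "K \<union> v ` {..<Suc n} = insert (v n) (K \<union> v ` {..<n})" by (simp add: lessThan_Suc)
  then show ?case using Suc by (simp add: dim_insert)
qed simp

text \<open>The \<open>n\<close> vectors lie in the quotient of \<open>K + W\<close> by
  \<open>K\<close>, whose dimension is less than \<open>n\<close>, so some \<open>v q0\<close>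
  depends on its predecessors modulo \<open>K\<close>. Its coefficient can be taken to be 1, which
  removes the factor \<open>\<alpha> q0\<close> from the determinant identities.\<close>

lemma exists_relation:
  assumes K: "subspace K" and n: "dim (K \<union> W) < dim K + n" and v: "\<And>q. q < n \<Longrightarrow> v q \<in> span (K \<union> W)"
  shows "\<exists>q0 \<alpha>. q0 < n \<and> \<alpha> q0 = 1 \<and> (\<Sum>q<n. scale (\<alpha> q) (v q)) \<in> K"
proof -
  have "\<exists>q0<n. v q0 \<in> span (K \<union> v ` {..<q0})"
  proof (rule ccontr)
    assume "\<not> ?thesis"
    then have "dim (K \<union> v ` {..<n}) = dim K + n" by (intro dim_Un_image) blast
    moreover have "K \<union> v ` {..<n} \<subseteq> span (K \<union> W)" using v by (auto intro: span_base)
    then have "dim (K \<union> v ` {..<n}) \<le> dim (K \<union> W)" by (rule dim_mono)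
    ultimately show False using n by simp
  qed
  then obtain q0 \<beta> where q0: "q0 < n" and \<beta>: "v q0 - (\<Sum>q<q0. scale (\<beta> q) (v q)) \<in> K"
    using mem_span_Un_image[OF K] by blast
  define \<alpha> where "\<alpha> q = (if q = q0 then 1 else if q < q0 then - \<beta> q else 0)" for q
  have "(\<Sum>q<n. scale (\<alpha> q) (v q)) = (\<Sum>q<Suc q0. scale (\<alpha> q) (v q))"
    by (rule sum.mono_neutral_right) (use q0 in \<open>auto simp: \<alpha>_def\<close>)
  also have "\<dots> = v q0 - (\<Sum>q<q0. scale (\<beta> q) (v q))"
    by (simp add: \<alpha>_def sum_negf)
  finally show ?thesis using q0 \<beta> by (intro exI[of _ q0] exI[of _ \<alpha>]) (simp add: \<alpha>_def)
qed

text \<open>A greedy choice, as \<open>W\<close> cannot lie in the span of \<open>K\<close> and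
  fewer than \<open>n\<close> vectors. \<open>W\<close> is a mere set because the vectors will be
  picked among the given spanning vectors of \<open>L\<close>, the only possible columns of a
  minor.\<close>

lemma exists_independent_family:
  assumes "dim K + n \<le> dim (K \<union> W)"
  shows "\<exists>v. \<forall>q<n. v q \<in> W \<and> v q \<notin> span (K \<union> v ` {..<q})"
  using assms
proof (induction n)
  case (Suc n)
  then obtain v where v: "\<forall>q<n. v q \<in> W \<and> v q \<notin> span (K \<union> v ` {..<q})" by auto
  have "dim (K \<union> v ` {..<n}) = dim K + n" using v by (intro dim_Un_image) blast
  moreover have "dim (K \<union> W) \<le> dim (K \<union> v ` {..<n})" if "K \<union> W \<subseteq> span (K \<union> v ` {..<n})"
    using that by (rule dim_mono)
  ultimately have "\<not> K \<union> W \<subseteq> span (K \<union> v ` {..<n})" using Suc.prems by auto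
  moreover have "K \<subseteq> span (K \<union> v ` {..<n})" by (meson Un_upper1 span_superset subset_trans)
  ultimately obtain w where w: "w \<in> W" "w \<notin> span (K \<union> v ` {..<n})" by blast
  have img: "(v(n := w)) ` {..<q} = v ` {..<q}" if "q \<le> n" for q using that by auto
  have "\<forall>q<Suc n. (v(n := w)) q \<in> W \<and> (v(n := w)) q \<notin> span (K \<union> (v(n := w)) ` {..<q})"
  proof (intro allI impI)
    fix q assume "q < Suc n"
    then have q: "q \<le> n" by simp
    show "(v(n := w)) q \<in> W \<and> (v(n := w)) q \<notin> span (K \<union> (v(n := w)) ` {..<q})"
      unfolding img[OF q] using q v w by (cases "q = n") auto
  qed
  then show ?case by blast
qed simp

end

section \<open>Determinantal conditions to first order\<close>

definition (in vector_space) chart_vec :: "nat \<Rightarrow> nat \<Rightarrow> (nat \<Rightarrow> 'b) \<Rightarrow> (nat \<times> nat \<Rightarrow> 'a) \<Rightarrow> nat \<Rightarrow> 'b"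
  where "chart_vec r d e x s = e s + (\<Sum>j<d - (r + 1). scale (x (s, j)) (e (r + 1 + j)))"

text \<open>The \<epsilon>-part of \<open>chart_vec\<close> at \<open>x + \<epsilon> y\<close>. It
  lies in the span of the last \<open>d - (r + 1)\<close> vectors of \<open>e\<close>, so
  \<open>y\<close> is the matrix of a linear map from \<open>L\<close> to a complement of
  \<open>L\<close>.\<close>

definition (in vector_space) chart_dir :: "nat \<Rightarrow> nat \<Rightarrow> (nat \<Rightarrow> 'b) \<Rightarrow> (nat \<times> nat \<Rightarrow> 'a) \<Rightarrow> nat \<Rightarrow> 'b"
  where "chart_dir r d e y s = (\<Sum>j<d - (r + 1). scale (y (s, j)) (e (r + 1 + j)))"

lemma universal_entry_in_poly_ring:
  "s \<le> r \<Longrightarrow> universal_entry r d e \<psi> s \<in> carrier (poly_ring (chart_vars r d))"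
  unfolding universal_entry_def
  by (intro poly_ring_add poly_ring_sum poly_ring_mult poly_const_in_poly_ring poly_var_in_poly_ring)
    (simp add: chart_vars_def)

lemma det_in_poly_ring:
  fixes M :: "nat \<Rightarrow> nat \<Rightarrow> ('v, 'k::comm_ring_1) mv_poly"
  assumes "\<And>p q. p < n \<Longrightarrow> q < n \<Longrightarrow> M p q \<in> carrier (poly_ring V)"
  shows "det (mat n n (\<lambda>(p, q). M p q)) \<in> carrier (poly_ring V)"
proof -
  have prod: "prod f A \<in> carrier (poly_ring V)" if "\<And>i. i \<in> A \<Longrightarrow> f i \<in> carrier (poly_ring V)"
    for f :: "nat \<Rightarrow> ('v, 'k) mv_poly" and A
    using that poly_const_in_poly_ring[of 1 V]
    by (induction A rule: infinite_finite_induct) (auto intro: poly_ring_mult simp: poly_const_1)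
  have sgn: "of_int (sign \<pi>) \<in> carrier (poly_ring V :: ('v, 'k) mv_poly ring)" for \<pi> :: "nat \<Rightarrow> nat"
    using poly_const_in_poly_ring[of 1 V] poly_ring_uminus[of 1 V]
    by (auto simp: sign_def poly_const_1)
  show ?thesis
    unfolding det_def'[OF mat_carrier]
  proof (intro poly_ring_sum poly_ring_mult prod sgn)
    fix \<pi> i assume "\<pi> \<in> {\<pi>. \<pi> permutes {0..<n}}" "i \<in> {0..<n}"
    then have "i < n" "\<pi> i < n" using permutes_in_image[of \<pi> "{0..<n}" i] by auto
    then show "mat n n (\<lambda>(p, q). M p q) $$ (i, \<pi> i) \<in> carrier (poly_ring V)" using assms by simp
  qed
qed

context vector_space begin

text \<open>The entry has degree at most one in the chart variables, so no power of \<epsilon>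
  beyond the first occurs.\<close>

lemma dual_eval_universal_entry:
  assumes "Vector_Spaces.linear scale (*) \<psi>"
  shows "dual_eval x y (universal_entry r d e \<psi> s) =
    [:\<psi> (chart_vec r d e x s), \<psi> (chart_dir r d e y s):]"
proof -
  interpret \<psi>: Vector_Spaces.linear scale "(*)" \<psi> by fact
  have "(\<Sum>j\<in>A. [:f j:] * [:g j, h j:]) = [:\<Sum>j\<in>A. g j * f j, \<Sum>j\<in>A. h j * f j:]"
    for A :: "nat set" and f g h :: "nat \<Rightarrow> 'a"
    by (induction A rule: infinite_finite_induct) (auto simp: mult.commute)
  then show ?thesis
    unfolding universal_entry_def chart_vec_def chart_dir_def
    by (simp only: dual_eval_add dual_eval_sum dual_eval_mult dual_eval_const dual_eval_var
        \<psi>.add \<psi>.sum \<psi>.scale) simp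
qed

lemma dual_eval_minor:
  assumes "\<And>p. p < n \<Longrightarrow> Vector_Spaces.linear scale (*) (\<psi> p)"
  shows "dual_eval x y (det (mat n n (\<lambda>(p, q). universal_entry r d e (\<psi> p) (c q)))) =
    det (mat n n (\<lambda>(p, q). [:\<psi> p (chart_vec r d e x (c q)), \<psi> p (chart_dir r d e y (c q)):]))"
proof -
  interpret comm_ring_hom "dual_eval x y" by (rule dual_eval_hom)
  show ?thesis
    unfolding hom_det[symmetric]
    by (intro arg_cong[of _ _ det] eq_matI) (auto simp: assms dual_eval_universal_entry)
qed

lemma poly_eval_minor:
  assumes "\<And>p. p < n \<Longrightarrow> Vector_Spaces.linear scale (*) (\<psi> p)"
  shows "poly_eval x (det (mat n n (\<lambda>(p, q). universal_entry r d e (\<psi> p) (c q)))) =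
    det (mat n n (\<lambda>(p, q). \<psi> p (chart_vec r d e x (c q))))"
proof -
  interpret comm_ring_hom "\<lambda>p. poly p (0::'a)" by unfold_locales auto
  have "poly_eval x (det (mat n n (\<lambda>(p, q). universal_entry r d e (\<psi> p) (c q)))) =
      poly (det (mat n n (\<lambda>(p, q). [:\<psi> p (chart_vec r d e x (c q)), \<psi> p (chart_dir r d e x (c q)):]))) 0"
    using dual_eval_minor[of n \<psi> x x r d e c] assms by (simp add: poly_eval_dual[of x _ x] poly_0_coeff_0)
  then show ?thesis
    unfolding hom_det[symmetric]
    by (simp only:, intro arg_cong[of _ _ det] eq_matI, auto)
qed

end

context finite_dimensional_vector_space begin

text \<open>The functionals factor through the quotient by \<open>K\<close>, where the
  \<open>n\<close> vectors lie in a space of dimension less than \<open>n\<close>; hence the columns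
  are dependent.\<close>

lemma det_functionals_eq_0:
  fixes v :: "nat \<Rightarrow> 'b"
  assumes K: "subspace K" and n: "dim (K \<union> W) < dim K + n" and v: "\<And>q. q < n \<Longrightarrow> v q \<in> span (K \<union> W)"
    and \<psi>: "\<And>p. p < n \<Longrightarrow> Vector_Spaces.linear scale (*) (\<psi> p)" "\<And>p y. p < n \<Longrightarrow> y \<in> K \<Longrightarrow> \<psi> p y = 0"
  shows "det (mat n n (\<lambda>(p, q). \<psi> p (v q))) = 0"
proof -
  obtain q0 \<alpha> where q0: "q0 < n" "\<alpha> q0 = 1" and \<alpha>: "(\<Sum>q<n. scale (\<alpha> q) (v q)) \<in> K"
    using exists_relation[OF K n, of v] v by auto
  have 0: "(\<Sum>q<n. \<psi> p (v q) * \<alpha> q) = 0" if "p < n" for p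
  proof -
    interpret \<psi>: Vector_Spaces.linear scale "(*)" "\<psi> p" using \<psi>(1) that .
    show ?thesis using \<psi>(2)[OF that \<alpha>] by (simp add: \<psi>.sum \<psi>.scale mult.commute)
  qed
  have "det (mat n n (\<lambda>(p, q). \<psi> p (v q))) =
      det (mat n n (\<lambda>(p, q). if q = q0 then \<Sum>k<n. \<psi> p (v k) * \<alpha> k else \<psi> p (v q)))"
    using det_combine_columns[OF q0(1), of "\<lambda>p q. \<psi> p (v q)" \<alpha>] q0(2) by simp
  \<comment> \<open>The zero column is written \<open>0 * 0\<close> so that a factor 0 can be taken
    out of it.\<close>
  also have "\<dots> = det (mat n n (\<lambda>(p, q). if q = q0 then 0 * 0 else \<psi> p (v q)))"
    by (intro arg_cong[of _ _ det] eq_matI) (use 0 in auto)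
  also have "\<dots> = 0" unfolding det_scale_column[OF q0(1)] by simp
  finally show ?thesis .
qed

text \<open>The tangent space to the locus of maps of rank at most \<open>i\<close>: no condition at a map of smaller
  rank, and at a map of rank \<open>i\<close> the kernel has to be sent into the image. Here the map is
  \<open>L \<rightarrow> H / K\<close>, and \<open>\<phi>\<close> is the direction.\<close>

lemma minors_first_order:
  fixes u :: "nat \<Rightarrow> 'b"
  assumes K: "subspace K" and L: "L = span (u ` {..r})" and \<phi>: "Vector_Spaces.linear scale scale \<phi>"
    and rank: "dim (K \<union> L) \<le> dim K + i"
  shows "(\<forall>\<psi> c. (\<forall>p\<le>i. Vector_Spaces.linear scale (*) (\<psi> p) \<and> (\<forall>y\<in>K. \<psi> p y = 0)) \<and> (\<forall>q\<le>i. c q \<le> r) \<longrightarrow>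
      coeff (det (mat (i + 1) (i + 1) (\<lambda>(p, q). [:\<psi> p (u (c q)), \<psi> p (\<phi> (u (c q))):]))) 1 = 0) \<longleftrightarrow>
    (dim (K \<union> L) = dim K + i \<longrightarrow> (\<forall>v\<in>L \<inter> K. \<phi> v \<in> span (K \<union> L)))"
    (is "?minors \<longleftrightarrow> ?tangent")
proof
  interpret \<phi>: Vector_Spaces.linear scale scale \<phi> by fact
  have u: "u s \<in> L" if "s \<le> r" for s using that L by (auto intro: span_base)
  have sL: "subspace L" unfolding L by (rule subspace_span)
  {
    assume tangent: ?tangent
    show ?minors
    proof (intro allI impI, elim conjE)
      fix \<psi> c
      assume \<psi>: "\<forall>p\<le>i. Vector_Spaces.linear scale (*) (\<psi> p) \<and> (\<forall>y\<in>K. \<psi> p y = 0)" and c: "\<forall>q\<le>i. c q \<le> r"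
      have uc: "u (c q) \<in> span (K \<union> L)" if "q < i + 1" for q
        using that c u by (auto intro: span_base)
      \<comment> \<open>Rank at most \<open>i\<close> forces a relation among the
        \<open>i + 1\<close> columns modulo \<open>K\<close>. The combination \<open>v\<close> lies
        in \<open>L \<inter> K\<close>, so it is a kernel vector, and the derivative of the minor is
        the minor with column \<open>q0\<close> replaced by the values on
        \<open>\<phi> v\<close>.\<close>
      obtain q0 \<alpha> where q0: "q0 < i + 1" "\<alpha> q0 = 1" and \<alpha>: "(\<Sum>q<i + 1. scale (\<alpha> q) (u (c q))) \<in> K"
        using exists_relation[of K L "i + 1" "\<lambda>q. u (c q)"] K rank uc by auto
      define v where "v = (\<Sum>q<i + 1. scale (\<alpha> q) (u (c q)))"
      have vL: "v \<in> L" unfolding v_def using c u by (intro subspace_sum subspace_scale sL) auto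
      let ?w = "\<lambda>q. if q = q0 then \<phi> v else u (c q)"
      have sums: "(\<Sum>q<i + 1. \<psi> p (u (c q)) * \<alpha> q) = 0" "(\<Sum>q<i + 1. \<psi> p (\<phi> (u (c q))) * \<alpha> q) = \<psi> p (\<phi> v)"
        if "p < i + 1" for p
      proof -
        interpret \<psi>: Vector_Spaces.linear scale "(*)" "\<psi> p" using \<psi> that by simp
        have "\<psi> p v = 0" using \<psi> that \<alpha> unfolding v_def by auto
        then show "(\<Sum>q<i + 1. \<psi> p (u (c q)) * \<alpha> q) = 0"
          unfolding v_def \<psi>.sum \<psi>.scale by (simp add: mult.commute)
        show "(\<Sum>q<i + 1. \<psi> p (\<phi> (u (c q))) * \<alpha> q) = \<psi> p (\<phi> v)"
          unfolding v_def \<phi>.sum \<phi>.scale \<psi>.sum \<psi>.scale by (simp add: mult.commute)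
      qed
      have "coeff (det (mat (i + 1) (i + 1) (\<lambda>(p, q). [:\<psi> p (u (c q)), \<psi> p (\<phi> (u (c q))):]))) 1 =
          det (mat (i + 1) (i + 1) (\<lambda>(p, q). if q = q0 then \<Sum>k<i + 1. \<psi> p (\<phi> (u (c k))) * \<alpha> k else \<psi> p (u (c q))))"
        using coeff_1_det_singular[OF q0(1), of "\<lambda>p q. \<psi> p (u (c q))" \<alpha> "\<lambda>p q. \<psi> p (\<phi> (u (c q)))"] sums(1) q0(2)
        by simp
      also have "\<dots> = det (mat (i + 1) (i + 1) (\<lambda>(p, q). \<psi> p (?w q)))"
        by (intro arg_cong[of _ _ det] eq_matI) (use sums(2) in \<open>auto simp del: sum.lessThan_Suc\<close>)
      also have "\<dots> = 0"
      proof (rule det_functionals_eq_0[where W = "insert (\<phi> v) L", OF K])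
        \<comment> \<open>Adjoining \<open>\<phi> v\<close> raises a rank below \<open>i\<close> by
          at most one, and leaves rank \<open>i\<close> unchanged by \<open>?tangent\<close>; either
          way the rank stays at most \<open>i\<close>.\<close>
        have "dim (K \<union> insert (\<phi> v) L) = dim (insert (\<phi> v) (K \<union> L))" by simp
        also have "\<dots> < dim K + (i + 1)"
          using tangent rank vL \<alpha> by (auto simp: dim_insert v_def)
        finally show "dim (K \<union> insert (\<phi> v) L) < dim K + (i + 1)" .
        show "?w q \<in> span (K \<union> insert (\<phi> v) L)" if "q < i + 1" for q
          using that c u by (auto intro!: span_base)
      qed (use \<psi> in auto)
      finally show "coeff (det (mat (i + 1) (i + 1) (\<lambda>(p, q). [:\<psi> p (u (c q)), \<psi> p (\<phi> (u (c q))):]))) 1 = 0" .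
    qed
  }
  assume minors: ?minors
  show ?tangent
  proof (intro impI ballI)
    fix v0 assume eq: "dim (K \<union> L) = dim K + i" and v0: "v0 \<in> L \<inter> K"
    have spKL: "span (K \<union> u ` {..r}) = span (K \<union> L)"
      unfolding L by (simp add: span_Un span_span)
    then have dimKu: "dim (K \<union> u ` {..r}) = dim K + i"
      using eq by (metis dim_span)
    \<comment> \<open>At rank \<open>i\<close>, some \<open>i\<close> of the spanning vectors form a
      basis of \<open>L\<close> modulo \<open>K\<close>. They fill the first \<open>i\<close>
      columns of the test minors.\<close>
    obtain v where v: "\<forall>q<i. v q \<in> u ` {..r} \<and> v q \<notin> span (K \<union> v ` {..<q})"
      using exists_independent_family[of K i "u ` {..r}"] dimKu by auto
    then have "\<forall>q. \<exists>s. q < i \<longrightarrow> s \<le> r \<and> v q = u s" by blast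
    from choice[OF this] obtain c where c: "\<And>q. q < i \<Longrightarrow> c q \<le> r \<and> v q = u (c q)" by blast
    have dimv: "dim (K \<union> v ` {..<i}) = dim K + i" using v by (intro dim_Un_image) blast
    have spv: "span (K \<union> v ` {..<i}) = span (K \<union> L)"
      using dim_eq_span[of "K \<union> v ` {..<i}" "K \<union> u ` {..r}"] v dimv dimKu spKL by auto
    \<comment> \<open>Reducing \<open>u s\<close> by the basis \<open>v\<close> gives a kernel
      vector \<open>z\<close>. If \<open>\<phi> z\<close> were outside \<open>K + L\<close>, the
      vectors \<open>v 0\<close>, ..., \<open>v (i - 1)\<close>, \<open>\<phi> z\<close> would be
      independent modulo \<open>K\<close>, and suitable functionals would give the minor with
      columns \<open>v 0\<close>, ..., \<open>v (i - 1)\<close>, \<open>u s\<close> derivative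
      1.\<close>
    have key: "\<exists>g\<in>span (v ` {..<i}). u s - g \<in> K \<and> \<phi> (u s - g) \<in> span (K \<union> L)" if s: "s \<le> r" for s
    proof -
      have "u s \<in> span (K \<union> v ` {..<i})" unfolding spv using u[OF s] by (simp add: span_base)
      from mem_span_Un_image[OF K this] obtain \<beta> where \<beta>: "u s - (\<Sum>q<i. scale (\<beta> q) (v q)) \<in> K" by blast
      define z where "z = u s - (\<Sum>q<i. scale (\<beta> q) (v q))"
      have "\<phi> z \<in> span (K \<union> L)"
      proof (rule ccontr)
        assume notin: "\<phi> z \<notin> span (K \<union> L)"
        let ?w = "\<lambda>q. if q = i then \<phi> z else v q"
        have img: "?w ` {..<q} = v ` {..<q}" if "q \<le> i" for q using that by force
        have "?w q \<notin> span (K \<union> ?w ` {..<q})" if "q < i + 1" for q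
        proof -
          have "q \<le> i" using that by simp
          then show ?thesis unfolding img[OF \<open>q \<le> i\<close>] using v notin spv by (cases "q = i") auto
        qed
        from det_functionals[OF this] obtain \<psi> where
          \<psi>: "\<forall>p<i + 1. Vector_Spaces.linear scale (*) (\<psi> p) \<and> (\<forall>y\<in>K. \<psi> p y = 0)"
          and det: "det (mat (i + 1) (i + 1) (\<lambda>(p, q). \<psi> p (?w q))) = 1" by blast
        define c' where "c' q = (if q = i then s else c q)" for q
        define \<alpha> where "\<alpha> q = (if q = i then 1 else - \<beta> q)" for q
        have "(\<Sum>q<i. scale (- \<beta> q) (v q)) = (\<Sum>q<i. scale (\<alpha> q) (u (c' q)))"
          by (rule sum.cong) (use c in \<open>auto simp: c'_def \<alpha>_def\<close>)
        then have z: "z = (\<Sum>q<i + 1. scale (\<alpha> q) (u (c' q)))"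
          by (simp add: z_def sum_negf) (simp add: \<alpha>_def c'_def)
        have sums: "(\<Sum>q<i + 1. \<psi> p (u (c' q)) * \<alpha> q) = 0" "(\<Sum>q<i + 1. \<psi> p (\<phi> (u (c' q))) * \<alpha> q) = \<psi> p (\<phi> z)"
          if "p < i + 1" for p
        proof -
          interpret \<psi>: Vector_Spaces.linear scale "(*)" "\<psi> p" using \<psi> that by simp
          have "\<psi> p z = 0" using \<psi> that \<beta> unfolding z_def by auto
          then show "(\<Sum>q<i + 1. \<psi> p (u (c' q)) * \<alpha> q) = 0"
            unfolding z \<psi>.sum \<psi>.scale by (simp add: mult.commute)
          show "(\<Sum>q<i + 1. \<psi> p (\<phi> (u (c' q))) * \<alpha> q) = \<psi> p (\<phi> z)"
            unfolding z \<phi>.sum \<phi>.scale \<psi>.sum \<psi>.scale by (simp add: mult.commute)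
        qed
        have "coeff (det (mat (i + 1) (i + 1) (\<lambda>(p, q). [:\<psi> p (u (c' q)), \<psi> p (\<phi> (u (c' q))):]))) 1 =
            det (mat (i + 1) (i + 1) (\<lambda>(p, q). if q = i then \<Sum>k<i + 1. \<psi> p (\<phi> (u (c' k))) * \<alpha> k else \<psi> p (u (c' q))))"
          using coeff_1_det_singular[of i "i + 1" "\<lambda>p q. \<psi> p (u (c' q))" \<alpha> "\<lambda>p q. \<psi> p (\<phi> (u (c' q)))"] sums(1)
          by (simp add: \<alpha>_def)
        also have "\<dots> = det (mat (i + 1) (i + 1) (\<lambda>(p, q). \<psi> p (?w q)))"
          by (intro arg_cong[of _ _ det] eq_matI)
            (use sums(2) c in \<open>auto simp: c'_def simp del: sum.lessThan_Suc\<close>)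
        also have "\<dots> = 1" by (rule det)
        finally have "coeff (det (mat (i + 1) (i + 1) (\<lambda>(p, q). [:\<psi> p (u (c' q)), \<psi> p (\<phi> (u (c' q))):]))) 1 = 1" .
        moreover have "\<forall>q\<le>i. c' q \<le> r" using c s by (auto simp: c'_def)
        moreover have "\<forall>p\<le>i. Vector_Spaces.linear scale (*) (\<psi> p) \<and> (\<forall>y\<in>K. \<psi> p y = 0)" using \<psi> by simp
        ultimately show False using minors by fastforce
      qed
      moreover have "(\<Sum>q<i. scale (\<beta> q) (v q)) \<in> span (v ` {..<i})"
        by (intro span_sum span_scale span_base) auto
      ultimately show ?thesis using \<beta> unfolding z_def by blast
    qed
    \<comment> \<open>The property found for the spanning vectors is preserved by linear
      combinations, so it holds on all of \<open>L\<close>; \<open>g\<close> is the component of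
      \<open>w\<close> along the basis \<open>v\<close>.\<close>
    have "\<exists>g\<in>span (v ` {..<i}). w - g \<in> K \<and> \<phi> (w - g) \<in> span (K \<union> L)" if "w \<in> span (u ` {..r})" for w
      using that
    proof (induction rule: span_induct_alt)
      case base
      show ?case using K by (intro bexI[of _ 0]) (auto simp: span_zero subspace_0)
    next
      case (step c w w')
      obtain g where g: "g \<in> span (v ` {..<i})" "w - g \<in> K" "\<phi> (w - g) \<in> span (K \<union> L)"
        using step key by blast
      obtain g' where g': "g' \<in> span (v ` {..<i})" "w' - g' \<in> K" "\<phi> (w' - g') \<in> span (K \<union> L)"
        using step by blast
      have *: "scale c w + w' - (scale c g + g') = scale c (w - g) + (w' - g')"
        by (simp add: algebra_simps)
      show ?case
        by (rule bexI[of _ "scale c g + g'"])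
          (use g g' K in \<open>auto simp: * \<phi>.add \<phi>.scale subspace_add subspace_scale span_add span_scale\<close>)
    qed
    then obtain g where g: "g \<in> span (v ` {..<i})" "v0 - g \<in> K" "\<phi> (v0 - g) \<in> span (K \<union> L)"
      using v0 L by blast
    \<comment> \<open>For a kernel vector \<open>v0\<close> the component \<open>g\<close> lies in
      \<open>K\<close> too. As the \<open>v q\<close> are independent modulo \<open>K\<close>, it
      must vanish.\<close>
    have "g = v0 - (v0 - g)" by simp
    then have "g \<in> K" using v0 g(2) subspace_diff[OF K] by (metis IntD2)
    moreover have "K \<inter> span (v ` {..<i}) \<subseteq> {0}"
    proof -
      have "dim (span (v ` {..<i})) \<le> i"
        using dim_le_card'[of "v ` {..<i}"] card_image_le[of "{..<i}" v] by simp
      moreover have "span (K \<union> span (v ` {..<i})) = span (K \<union> v ` {..<i})"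
        by (simp add: span_Un span_span)
      then have "dim (K \<union> span (v ` {..<i})) = dim K + i"
        using span_eq_dim[of "K \<union> span (v ` {..<i})" "K \<union> v ` {..<i}"] dimv by (simp only:)
      ultimately have "dim (K \<inter> span (v ` {..<i})) = 0"
        using dim_Un_Int[OF K subspace_span, of "v ` {..<i}"] by linarith
      then show ?thesis by simp
    qed
    ultimately have "g = 0" using g(1) by blast
    then show "\<phi> v0 \<in> span (K \<union> L)" using g(3) by simp
  qed
qed

end

section \<open>Conditions at active indices\<close>

lemma last_active_le: "last_active a j \<le> j"
proof (cases "\<exists>i\<le>j. active a i")
  case True
  then have "Max {i. i \<le> j \<and> active a i} \<in> {i. i \<le> j \<and> active a i}" by (intro Max_in) auto
  then show ?thesis by (simp add: last_active_def True)
qed (auto simp: last_active_def)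

text \<open>In the second case the default index 0 stands for the whole space:
  \<open>a 0 = 0\<close> means that the flag step attached to it has codimension 0, so its dimension
  condition is an equality just as at an active index.\<close>

lemma active_last_active: "active a (last_active a j) \<or> last_active a j = 0 \<and> a 0 = 0"
proof (cases "\<exists>i\<le>j. active a i")
  case True
  then have "Max {i. i \<le> j \<and> active a i} \<in> {i. i \<le> j \<and> active a i}" by (intro Max_in) auto
  then show ?thesis using True by (simp add: last_active_def)
next
  case False
  then have "\<not> active a 0" by simp
  then have "a 0 = 0" by (simp add: active_def)
  then show ?thesis unfolding last_active_def if_not_P[OF False] by simp
qed

lemma le_last_active: "active a i \<Longrightarrow> i \<le> j \<Longrightarrow> i \<le> last_active a j"
  by (auto simp: last_active_def intro!: Max_ge)

text \<open>The hypothesis is weaker than \<open>i \<le> j\<close>. This matters because the basis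
  vectors spanning the flag step at \<open>last_active a i\<close> already start at that index,
  which may be less than \<open>i\<close>.\<close>

lemma last_active_mono:
  assumes "last_active a i \<le> j"
  shows "last_active a i \<le> last_active a j"
  using active_last_active[of a i] le_last_active[of a "last_active a i" j] assms by auto

text \<open>A strictly increasing sequence grows by exactly one at each inactive positive index, so
  \<open>a i - i\<close> is constant from \<open>last_active a j\<close> up to \<open>j\<close>.
  This is why the dimension formula involves \<open>a j\<close> although the flag step is taken at
  the last active index.\<close>

lemma last_active_value:
  assumes a: "strict_mono_on {..r} a" and j: "j \<le> r"
  shows "a j = a (last_active a j) + (j - last_active a j)"
proof -
  have "a (last_active a j + k) = a (last_active a j) + k" if "last_active a j + k \<le> j" for k
    using that
  proof (induction k)
    case (Suc k)
    let ?i = "last_active a j + Suc k"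
    have "\<not> active a ?i" using le_last_active[of a ?i j] Suc.prems by auto
    then have "a ?i \<le> a (?i - 1) + 1" by (auto simp: active_def)
    moreover have "a (?i - 1) < a ?i"
      using Suc.prems j by (intro strict_mono_onD[OF a]) auto
    ultimately show ?case using Suc by simp
  qed simp
  from this[of "j - last_active a j"] show ?thesis using last_active_le[of a j] by simp
qed

section \<open>Flags induced on a subspace\<close>

context finite_dimensional_vector_space begin

lemma complete_flagD:
  assumes "complete_flag n W F"
  shows complete_flag_0: "F 0 = W"
    and complete_flag_subspace: "k \<le> n \<Longrightarrow> subspace (F k)"
    and complete_flag_dim: "k \<le> n \<Longrightarrow> dim (F k) = n - k"
    and complete_flag_mono: "k \<le> k' \<Longrightarrow> k' \<le> n \<Longrightarrow> F k' \<subseteq> F k"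
proof -
  show "F 0 = W" "k \<le> n \<Longrightarrow> subspace (F k)" "k \<le> n \<Longrightarrow> dim (F k) = n - k"
    using assms by (auto simp: complete_flag_def)
  have step: "F (Suc i) \<subseteq> F i" if "i < n" for i
    using assms that by (simp add: complete_flag_def)
  assume "k \<le> k'" "k' \<le> n"
  then show "F k' \<subseteq> F k"
  proof (induction k' rule: dec_induct)
    case (step i)
    then show ?case using \<open>\<And>i. i < n \<Longrightarrow> F (Suc i) \<subseteq> F i\<close>[of i] by auto
  qed simp
qed

text \<open>Any two of the intersections are nested, so equal dimension makes them equal and the
  definite description is well defined.\<close>

lemma induced_flag_eq:
  assumes F: "complete_flag d UNIV F" and d: "dim UNIV = d" and L: "subspace L"
    and k: "k \<le> d" "dim (L \<inter> F k) + i = dim L"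
  shows "induced_flag L F i = L \<inter> F k"
  unfolding induced_flag_def
proof (rule the_equality)
  show "L \<inter> F k \<in> {L \<inter> F j |j. j \<le> dim UNIV} \<and> dim (L \<inter> F k) + i = dim L"
    using k d by blast
  fix W assume "W \<in> {L \<inter> F j |j. j \<le> dim UNIV} \<and> dim W + i = dim L"
  then obtain j where j: "j \<le> d" "W = L \<inter> F j" "dim (L \<inter> F j) + i = dim L" using d by auto
  have sub: "subspace (L \<inter> F j)" "subspace (L \<inter> F k)"
    using complete_flag_subspace[OF F] j k L by (auto intro: subspace_inter)
  show "W = L \<inter> F k"
  proof (cases "j \<le> k")
    case True
    then have "L \<inter> F k \<subseteq> L \<inter> F j" using complete_flag_mono[OF F _ k(1)] by blast
    from subspace_dim_equal[OF sub(2,1) this] show ?thesis using j k by simp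
  next
    case False
    then have "L \<inter> F j \<subseteq> L \<inter> F k" using complete_flag_mono[OF F _ j(1), of k] by auto
    from subspace_dim_equal[OF sub this] show ?thesis using j k by simp
  qed
qed

text \<open>Along the flag the dimension of the intersection falls from \<open>dim L\<close> to 0 in
  steps of at most one, so it takes every value between. The least \<open>k\<close> at which it has
  fallen by at least \<open>i\<close> is the one wanted.\<close>

lemma induced_flag_exists:
  assumes F: "complete_flag d UNIV F" and L: "subspace L" and i: "i \<le> dim L"
  shows "\<exists>k\<le>d. dim (L \<inter> F k) + i = dim L"
proof -
  have drop: "dim (L \<inter> F k) \<le> dim (L \<inter> F (Suc k)) + 1" if "Suc k \<le> d" for k
  proof -
    have sub: "subspace (L \<inter> F k)" "subspace (F (Suc k))"
      using complete_flag_subspace[OF F] that L by (auto intro: subspace_inter)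
    have mono: "F (Suc k) \<subseteq> F k" by (rule complete_flag_mono[OF F]) (use that in auto)
    then have "dim (L \<inter> F k \<union> F (Suc k)) \<le> dim (F k)" by (intro dim_subset) auto
    moreover have "L \<inter> F k \<inter> F (Suc k) = L \<inter> F (Suc k)" using mono by blast
    ultimately show ?thesis
      using dim_Un_Int[OF sub] complete_flag_dim[OF F, of k] complete_flag_dim[OF F, of "Suc k"] that by simp
  qed
  have "dim (F d) = 0" using complete_flag_dim[OF F, of d] by simp
  then have "L \<inter> F d \<subseteq> {0}" by auto
  then have "dim (L \<inter> F d) = 0" unfolding dim_eq_0 .
  then have ex: "\<exists>k. k \<le> d \<and> dim (L \<inter> F k) + i \<le> dim L"
    using i by (intro exI[of _ d] conjI order_refl) linarith
  define k where "k = (LEAST k. k \<le> d \<and> dim (L \<inter> F k) + i \<le> dim L)"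
  have k: "k \<le> d" "dim (L \<inter> F k) + i \<le> dim L"
    using LeastI_ex[OF ex] by (auto simp: k_def)
  moreover have "dim (L \<inter> F k) + i \<ge> dim L"
  proof (cases k)
    case 0
    then show ?thesis using complete_flag_0[OF F] by simp
  next
    case (Suc k')
    have "\<not> (k' \<le> d \<and> dim (L \<inter> F k') + i \<le> dim L)"
      using not_less_Least[of k' "\<lambda>k. k \<le> d \<and> dim (L \<inter> F k) + i \<le> dim L"] Suc by (simp add: k_def)
    then show ?thesis using drop[of k'] k(1) Suc by simp
  qed
  ultimately show ?thesis by (intro exI[of _ k]) simp
qed

lemma induced_flag_mono:
  assumes F: "complete_flag d UNIV F" and d: "dim UNIV = d" and L: "subspace L"
    and ij: "i \<le> j" "j \<le> dim L"
  shows "induced_flag L F j \<subseteq> induced_flag L F i"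
proof -
  obtain k where k: "k \<le> d" "dim (L \<inter> F k) + j = dim L" using induced_flag_exists[OF F L ij(2)] by blast
  obtain l where l: "l \<le> d" "dim (L \<inter> F l) + i = dim L"
    using induced_flag_exists[OF F L, of i] ij by auto
  have "L \<inter> F k \<subseteq> L \<inter> F l"
  proof (cases "l \<le> k")
    case True
    then show ?thesis using complete_flag_mono[OF F _ k(1)] by blast
  next
    case False
    then have "L \<inter> F l \<subseteq> L \<inter> F k" using complete_flag_mono[OF F _ l(1), of k] by auto
    moreover have "subspace (L \<inter> F l)" "subspace (L \<inter> F k)"
      using complete_flag_subspace[OF F] l k L by (auto intro: subspace_inter)
    ultimately have "L \<inter> F l = L \<inter> F k" using k l ij by (intro subspace_dim_equal) auto
    then show ?thesis by simp
  qed
  then show ?thesis using induced_flag_eq[OF F d L k] induced_flag_eq[OF F d L l] by simp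
qed

text \<open>By monotonicity all vectors from index \<open>i\<close> on lie in this step; they are
  independent, and their number \<open>n - i\<close> is its dimension.\<close>

lemma flag_step_eq_span:
  assumes F: "complete_flag d UNIV F" and d: "dim UNIV = d" and L: "subspace L" "dim L = n"
    and lam: "ordered_basis n L lam" "\<And>i. i < n \<Longrightarrow> lam i \<in> induced_flag L F i"
    and k: "k \<le> d" "dim (L \<inter> F k) + i = n"
  shows "L \<inter> F k = span (lam ` {i..<n})"
proof -
  have ind: "induced_flag L F i = L \<inter> F k" using induced_flag_eq[OF F d L(1) k(1)] k(2) L(2) by simp
  have sub: "lam ` {i..<n} \<subseteq> L \<inter> F k"
    using lam(2) induced_flag_mono[OF F d L(1), of i] L(2) ind by fastforce
  have indep: "independent (lam ` {i..<n})"
    using lam(1) by (auto simp: ordered_basis_def elim!: independent_mono)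
  have "inj_on lam {i..<n}" using lam(1) by (auto simp: ordered_basis_def elim!: inj_on_subset)
  then have "card (lam ` {i..<n}) = dim (L \<inter> F k)" using k by (simp add: card_image)
  then have "L \<inter> F k \<subseteq> span (lam ` {i..<n})"
    using card_ge_dim_independent[OF sub indep] by simp
  moreover have "span (lam ` {i..<n}) \<subseteq> L \<inter> F k"
    using sub complete_flag_subspace[OF F k(1)] L(1) by (intro span_minimal subspace_inter)
  ultimately show ?thesis by blast
qed

lemma strict_mono_on_le_last:
  assumes "strict_mono_on {..r} a" "a r < d" "i \<le> r"
  shows "a i \<le> (d::nat)" and "i \<le> a i"
proof -
  show "a i \<le> d"
    using assms strict_mono_onD[OF assms(1), of i r] by (cases "i = r") auto
  show "i \<le> a i"
    using assms(3)
  proof (induction i)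
    case (Suc i)
    then show ?case using strict_mono_onD[OF assms(1), of i "Suc i"] by simp
  qed simp
qed

lemma dim_Int_last_active:
  assumes F: "complete_flag d UNIV F" and L: "L \<in> open_schubert_points r F a" and j: "j \<le> r"
  shows "dim (L \<inter> F (a (last_active a j))) + last_active a j = r + 1"
proof -
  have le: "last_active a j \<le> r" using last_active_le[of a j] j by simp
  from active_last_active[of a j] show ?thesis
  proof
    assume "active a (last_active a j)"
    then show ?thesis using L le by (simp add: open_schubert_points_def)
  next
    assume "last_active a j = 0 \<and> a 0 = 0"
    then show ?thesis
      using L complete_flag_0[OF F] by (simp add: open_schubert_points_def schubert_points_def grassmannian_def)
  qed
qed

text \<open>With \<open>i = last_active a j\<close> the modular law gives dimension
  \<open>d - a i + i\<close>, and \<open>a i - i = a j - j\<close>.\<close>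

lemma dim_Un_last_active:
  assumes F: "complete_flag d UNIV F" and L: "L \<in> open_schubert_points r F a"
    and a: "strict_mono_on {..r} a" "a r < d" and j: "j \<le> r"
  shows "dim (F (a (last_active a j)) \<union> L) + a j = d + j"
proof -
  have le: "last_active a j \<le> r" using last_active_le[of a j] j by simp
  have L': "subspace L" "dim L = r + 1"
    using L by (auto simp: open_schubert_points_def schubert_points_def grassmannian_def)
  let ?m = "a (last_active a j)"
  have m: "?m \<le> d" by (rule strict_mono_on_le_last[OF a le])
  have "dim (F ?m \<union> L) + dim (L \<inter> F ?m) = dim (F ?m) + dim L"
    using dim_Un_Int[OF complete_flag_subspace[OF F m] L'(1)] by (simp add: Int_commute)
  then show ?thesis
    using dim_Int_last_active[OF F L j] complete_flag_dim[OF F m] L'(2) m last_active_le[of a j]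
      last_active_value[OF a(1) j] by linarith
qed

text \<open>The left side has one condition for each index at which the rank is exactly
  \<open>i\<close>, the right side one for each basis vector. The index
  \<open>last_active a j\<close> always has exact rank and its flag step contains
  \<open>lam j\<close>; conversely, an exact condition at \<open>i\<close> coincides with the one at
  \<open>last_active a i\<close> on the larger subspace spanned by a tail of the basis.\<close>

lemma flag_conditions_iff:
  assumes F: "complete_flag d UNIV F" and d: "dim UNIV = d"
    and a: "strict_mono_on {..r} a" "a r < d" and L: "L \<in> open_schubert_points r F a"
    and lam: "ordered_basis (r + 1) L lam" "\<And>i. i < r + 1 \<Longrightarrow> lam i \<in> induced_flag L F i"
    and \<phi>: "Vector_Spaces.linear scale scale \<phi>"
  shows "(\<forall>i\<le>r. dim (L \<inter> F (a i)) + i = r + 1 \<longrightarrow> (\<forall>v\<in>L \<inter> F (a i). \<phi> v \<in> span (F (a i) \<union> L))) \<longleftrightarrow>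
    (\<forall>j\<le>r. \<phi> (lam j) \<in> span (F (a (last_active a j)) \<union> L))" (is "?A \<longleftrightarrow> ?B")
proof
  interpret \<phi>: Vector_Spaces.linear scale scale \<phi> by fact
  have L': "subspace L" "dim L = r + 1"
    using L by (auto simp: open_schubert_points_def schubert_points_def grassmannian_def)
  have le: "last_active a j \<le> r" if "j \<le> r" for j using last_active_le[of a j] that by simp
  have ad: "a i \<le> d" if "i \<le> r" for i by (rule strict_mono_on_le_last[OF a that])
  have flag: "L \<inter> F (a (last_active a j)) = span (lam ` {last_active a j..<r + 1})" if "j \<le> r" for j
    by (rule flag_step_eq_span[OF F d L' lam ad[OF le[OF that]] dim_Int_last_active[OF F L that]])
  {
    assume A: ?A
    show ?B
    proof (intro allI impI)
      fix j assume j: "j \<le> r"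
      have "lam j \<in> L \<inter> F (a (last_active a j))"
        unfolding flag[OF j] using j last_active_le[of a j] by (intro span_base) auto
      then show "\<phi> (lam j) \<in> span (F (a (last_active a j)) \<union> L)"
        using A le[OF j] dim_Int_last_active[OF F L j] by blast
    qed
  }
  assume B: ?B
  show ?A
  proof (intro allI impI ballI)
    fix i v assume i: "i \<le> r" and dim: "dim (L \<inter> F (a i)) + i = r + 1" and v: "v \<in> L \<inter> F (a i)"
    let ?m = "a (last_active a i)"
    have mle: "?m \<le> a i" using last_active_value[OF a(1) i] by simp
    have sub: "F (a i) \<subseteq> F ?m" by (rule complete_flag_mono[OF F mle ad[OF i]])
    have "dim (F (a i) \<union> L) + dim (L \<inter> F (a i)) = dim (F (a i)) + dim L"
      using dim_Un_Int[OF complete_flag_subspace[OF F ad[OF i]] L'(1)] by (simp add: Int_commute)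
    then have "dim (F (a i) \<union> L) + a i = d + i"
      using dim complete_flag_dim[OF F ad[OF i]] L'(2) ad[OF i] by linarith
    \<comment> \<open>Both sums have dimension \<open>d + i - a i\<close>: the left one because the
      rank at \<open>i\<close> is exact, the right one because \<open>a\<close> grows by one at each
      step from the last active index to \<open>i\<close>.\<close>
    then have "span (F (a i) \<union> L) = span (F ?m \<union> L)"
      using dim_Un_last_active[OF F L a i] sub by (intro dim_eq_span) auto
    moreover have "v \<in> span (lam ` {last_active a i..<r + 1})"
      using v sub flag[OF i] by blast
    then have "\<phi> v \<in> span (F ?m \<union> L)"
    proof (rule span_induct)
      show "subspace {v. \<phi> v \<in> span (F ?m \<union> L)}"
        by (rule subspaceI) (auto simp: \<phi>.zero \<phi>.add \<phi>.scale span_zero span_add span_scale)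
      fix w assume "w \<in> lam ` {last_active a i..<r + 1}"
      then obtain j where j: "last_active a i \<le> j" "j \<le> r" "w = lam j" by auto
      \<comment> \<open>Later vectors of the tail satisfy at least as strong a condition, since
        their last active index is at least that of \<open>i\<close> and the flag decreases.\<close>
      have "last_active a i \<le> last_active a j" by (rule last_active_mono[OF j(1)])
      then have "?m \<le> a (last_active a j)"
        using strict_mono_onD[OF a(1), of "last_active a i" "last_active a j"] le[OF i] le[OF j(2)]
        by (cases "last_active a i = last_active a j") auto
      then have "F (a (last_active a j)) \<subseteq> F ?m"
        using complete_flag_mono[OF F _ ad[OF le[OF j(2)]]] by blast
      then have "span (F (a (last_active a j)) \<union> L) \<subseteq> span (F ?m \<union> L)"
        by (intro span_mono) auto
      then show "\<phi> w \<in> span (F ?m \<union> L)" using B j by blast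
    qed
    ultimately show "\<phi> v \<in> span (F (a i) \<union> L)" by simp
  qed
qed

end

section \<open>Dimension count\<close>

context finite_dimensional_vector_space begin

lemma chart_point_eq_span: "chart_point r d e x = span (chart_vec r d e x ` {..r})"
  unfolding chart_point_def chart_vec_def ..

lemma dim_Un_flag_step:
  assumes F: "complete_flag d UNIV F" and k: "k \<le> d" and L: "subspace L" "dim L = r + 1"
  shows "dim (F k \<union> L) + dim (L \<inter> F k) = dim (F k) + (r + 1)"
  using dim_Un_Int[OF complete_flag_subspace[OF F k] L(1)] L(2) by (simp add: Int_commute)

text \<open>\<open>L\<close> maps to the quotient by \<open>F (a i)\<close> with rank at most
  \<open>i\<close>, so all minors of size \<open>i + 1\<close> vanish at \<open>x\<close>. The
  generators must lie in the maximal ideal before the tangent space can be expressed by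
  derivatives.\<close>

lemma schubert_minors_subset_point_ideal:
  assumes F: "complete_flag d UNIV F" and a: "strict_mono_on {..r} a" "a r < d"
    and L: "chart_point r d e x \<in> schubert_points r F a"
  shows "schubert_minors r d e F a \<subseteq> point_ideal (chart_vars r d) x"
proof
  fix f assume "f \<in> schubert_minors r d e F a"
  then obtain i \<psi> c where i: "i \<le> r"
    and f: "f = det (mat (i + 1) (i + 1) (\<lambda>(p, q). universal_entry r d e (\<psi> p) (c q)))"
    and \<psi>: "\<forall>p\<le>i. Vector_Spaces.linear scale (*) (\<psi> p) \<and> (\<forall>v\<in>F (a i). \<psi> p v = 0)"
    and c: "\<forall>q\<le>i. c q \<le> r"
    unfolding schubert_minors_def by auto
  let ?L = "chart_point r d e x"
  have L': "subspace ?L" "dim ?L = r + 1" "dim (?L \<inter> F (a i)) \<ge> r + 1 - i"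
    using L i by (auto simp: schubert_points_def grassmannian_def)
  have ai: "a i \<le> d" by (rule strict_mono_on_le_last[OF a i])
  have "f \<in> carrier (poly_ring (chart_vars r d))"
    unfolding f using c by (intro det_in_poly_ring universal_entry_in_poly_ring) auto
  moreover have "poly_eval x f = det (mat (i + 1) (i + 1) (\<lambda>(p, q). \<psi> p (chart_vec r d e x (c q))))"
    unfolding f using \<psi> by (intro poly_eval_minor) auto
  moreover have "\<dots> = 0"
  proof (rule det_functionals_eq_0[OF complete_flag_subspace[OF F ai], of ?L])
    show "dim (F (a i) \<union> ?L) < dim (F (a i)) + (i + 1)"
      using dim_Un_flag_step[OF F ai L'(1,2)] L'(3) i by linarith
    show "chart_vec r d e x (c q) \<in> span (F (a i) \<union> ?L)" if "q < i + 1" for q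
      using that c by (auto simp: chart_point_eq_span intro!: span_base)
  qed (use \<psi> in auto)
  ultimately show "f \<in> point_ideal (chart_vars r d) x" by (simp add: point_ideal_def)
qed

text \<open>Since \<open>\<phi>\<close> sends each chart vector to its \<epsilon>-part, the
  derivative of a minor is the coefficient treated in \<open>minors_first_order\<close>, applied for
  each \<open>i\<close> separately. By the modular law,
  \<open>dim (L \<inter> F (a i)) + i = r + 1\<close> says that the rank is exactly
  \<open>i\<close>.\<close>

lemma dir_deriv_schubert_minors_iff:
  assumes F: "complete_flag d UNIV F" and a: "strict_mono_on {..r} a" "a r < d"
    and L: "L \<in> schubert_points r F a" "L = chart_point r d e x"
    and \<phi>: "Vector_Spaces.linear scale scale \<phi>" "\<And>s. s \<le> r \<Longrightarrow> \<phi> (chart_vec r d e x s) = chart_dir r d e y s"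
  shows "(\<forall>f\<in>schubert_minors r d e F a. dir_deriv x y f = 0) \<longleftrightarrow>
    (\<forall>i\<le>r. dim (L \<inter> F (a i)) + i = r + 1 \<longrightarrow> (\<forall>v\<in>L \<inter> F (a i). \<phi> v \<in> span (F (a i) \<union> L)))"
proof -
  let ?u = "chart_vec r d e x"
  let ?D = "\<lambda>i \<psi> c. coeff (det (mat (i + 1) (i + 1) (\<lambda>(p, q). [:\<psi> p (?u (c q)), \<psi> p (\<phi> (?u (c q))):]))) 1"
  let ?H = "\<lambda>i \<psi> c. (\<forall>p\<le>i. Vector_Spaces.linear scale (*) (\<psi> p) \<and> (\<forall>y\<in>F (a i). \<psi> p y = 0)) \<and> (\<forall>q\<le>i. c q \<le> r)"
  have D: "dir_deriv x y (det (mat (i + 1) (i + 1) (\<lambda>(p, q). universal_entry r d e (\<psi> p) (c q)))) = ?D i \<psi> c"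
    if H: "?H i \<psi> c" for i \<psi> c
  proof -
    have "dual_eval x y (det (mat (i + 1) (i + 1) (\<lambda>(p, q). universal_entry r d e (\<psi> p) (c q)))) =
      det (mat (i + 1) (i + 1) (\<lambda>(p, q). [:\<psi> p (?u (c q)), \<psi> p (chart_dir r d e y (c q)):]))"
      using H by (intro dual_eval_minor) auto
    also have "\<dots> = det (mat (i + 1) (i + 1) (\<lambda>(p, q). [:\<psi> p (?u (c q)), \<psi> p (\<phi> (?u (c q))):]))"
      by (intro arg_cong[of _ _ det] eq_matI) (use H \<phi>(2) in auto)
    finally show ?thesis by (simp only: dir_deriv_def)
  qed
  have minors: "f \<in> schubert_minors r d e F a \<longleftrightarrow>
      (\<exists>i \<psi> c. i \<le> r \<and> ?H i \<psi> c \<and> f = det (mat (i + 1) (i + 1) (\<lambda>(p, q). universal_entry r d e (\<psi> p) (c q))))" for f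
    unfolding schubert_minors_def by blast
  have "(\<forall>f\<in>schubert_minors r d e F a. dir_deriv x y f = 0) \<longleftrightarrow>
      (\<forall>i\<le>r. \<forall>\<psi> c. ?H i \<psi> c \<longrightarrow> dir_deriv x y (det (mat (i + 1) (i + 1) (\<lambda>(p, q). universal_entry r d e (\<psi> p) (c q)))) = 0)"
    unfolding Ball_def minors by blast
  also have "\<dots> \<longleftrightarrow> (\<forall>i\<le>r. \<forall>\<psi> c. ?H i \<psi> c \<longrightarrow> ?D i \<psi> c = 0)"
    by (intro all_cong all_cong1) (subst D, assumption, rule refl)
  also have "\<dots> \<longleftrightarrow> (\<forall>i\<le>r. dim (L \<inter> F (a i)) + i = r + 1 \<longrightarrow> (\<forall>v\<in>L \<inter> F (a i). \<phi> v \<in> span (F (a i) \<union> L)))"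
  proof (intro all_cong)
    fix i assume i: "i \<le> r"
    have ai: "a i \<le> d" by (rule strict_mono_on_le_last[OF a i])
    have L': "subspace L" "dim L = r + 1" "dim (L \<inter> F (a i)) \<ge> r + 1 - i"
      using L(1) i by (auto simp: schubert_points_def grassmannian_def)
    note dims = dim_Un_flag_step[OF F ai L'(1,2)]
    have rank: "dim (F (a i) \<union> L) \<le> dim (F (a i)) + i" using dims L'(3) i by linarith
    have "dim (F (a i) \<union> L) = dim (F (a i)) + i \<longleftrightarrow> dim (L \<inter> F (a i)) + i = r + 1"
      using dims by linarith
    then show "(\<forall>\<psi> c. ?H i \<psi> c \<longrightarrow> ?D i \<psi> c = 0) \<longleftrightarrow>
        (dim (L \<inter> F (a i)) + i = r + 1 \<longrightarrow> (\<forall>v\<in>L \<inter> F (a i). \<phi> v \<in> span (F (a i) \<union> L)))"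
      using minors_first_order[OF complete_flag_subspace[OF F ai] L(2)[unfolded chart_point_eq_span] \<phi>(1) rank]
      by simp
  qed
  finally show ?thesis .
qed

section \<open>Matrices of linear maps and their parameters\<close>

lemma ordered_basis_expand:
  assumes v: "ordered_basis n W v"
  shows "\<exists>c. \<forall>w\<in>W. w = (\<Sum>j<n. scale (c w j) (v j))"
proof -
  have inj: "inj_on v {..<n}" and sp: "span (v ` {..<n}) = W" using v by (auto simp: ordered_basis_def)
  have "\<exists>c. w = (\<Sum>j<n. scale (c j) (v j))" if w: "w \<in> W" for w
  proof -
    obtain f where "w = (\<Sum>b\<in>v ` {..<n}. scale (f b) b)"
      using w sp span_finite[of "v ` {..<n}"] by auto
    then show ?thesis using sum.reindex[OF inj] by (intro exI[of _ "f \<circ> v"]) simp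
  qed
  then show ?thesis by metis
qed

lemma ordered_basis_linear_extend:
  assumes v: "ordered_basis n W v"
  shows "\<exists>\<phi>. Vector_Spaces.linear scale scale \<phi> \<and> (\<forall>j<n. \<phi> (v j) = w j)"
proof -
  interpret pair: vector_space_pair scale scale by unfold_locales
  have inj: "inj_on v {..<n}" and ind: "independent (v ` {..<n})" using v by (auto simp: ordered_basis_def)
  obtain \<phi> where "Vector_Spaces.linear scale scale \<phi>" "\<forall>x\<in>v ` {..<n}. \<phi> x = w (inv_into {..<n} v x)"
    using pair.linear_independent_extend[OF ind, of "\<lambda>x. w (inv_into {..<n} v x)"] by blast
  then show ?thesis using inj by auto
qed

lemma ordered_basis_functionals:
  assumes v: "ordered_basis n W v"
  shows "\<exists>\<psi>. \<forall>t<n. Vector_Spaces.linear scale (*) (\<psi> t) \<and> (\<forall>t'<n. \<psi> t (v t') = (if t = t' then 1 else 0))"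
proof -
  interpret pair: vector_space_pair scale "(*) :: 'a \<Rightarrow> 'a \<Rightarrow> 'a"
    by (intro vector_space_pair.intro vector_space_self vector_space_axioms)
  have inj: "inj_on v {..<n}" and ind: "independent (v ` {..<n})" using v by (auto simp: ordered_basis_def)
  have "\<exists>\<psi>. Vector_Spaces.linear scale (*) \<psi> \<and> (\<forall>t'<n. \<psi> (v t') = (if t = t' then 1 else 0))" if "t < n" for t
  proof -
    obtain \<psi> where "Vector_Spaces.linear scale (*) \<psi>" "\<forall>x\<in>v ` {..<n}. \<psi> x = (if x = v t then 1 else 0)"
      using pair.linear_independent_extend[OF ind, of "\<lambda>x. if x = v t then 1 else 0"] by blast
    then show ?thesis using inj that by (intro exI[of _ \<psi>]) (auto simp: inj_on_def)
  qed
  then show ?thesis by metis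
qed

text \<open>A linear map \<open>L \<rightarrow> E\<close> is given either by its matrix \<open>y\<close> with respect to \<open>u\<close> and \<open>\<eta>\<close>, or freely by
  the images of the vectors of a second basis \<open>v\<close> of \<open>L\<close>.\<close>

lemma function_space_dim_constrained_maps:
  fixes k N :: nat and V :: "(nat \<times> nat) set" and u v \<eta> :: "nat \<Rightarrow> 'b"
  defines "V \<equiv> {..<k} \<times> {..<N}"
  assumes u: "ordered_basis k L u" and v: "ordered_basis k L v" and \<eta>: "ordered_basis N E \<eta>"
    and W: "\<And>j. j < k \<Longrightarrow> subspace (W j)" "\<And>j. j < k \<Longrightarrow> W j \<subseteq> E"
    and Y: "\<And>y \<phi>. Vector_Spaces.linear scale scale \<phi> \<Longrightarrow>
      (\<And>s. s < k \<Longrightarrow> \<phi> (u s) = (\<Sum>t<N. scale (y (s, t)) (\<eta> t))) \<Longrightarrow> (\<And>p. p \<notin> V \<Longrightarrow> y p = 0) \<Longrightarrow>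
      y \<in> Y \<longleftrightarrow> (\<forall>j<k. \<phi> (v j) \<in> W j)"
    and Y0: "\<And>y p. y \<in> Y \<Longrightarrow> p \<notin> V \<Longrightarrow> y p = 0"
  shows "function_space_dim Y = (\<Sum>j<k. dim (W j))"
proof -
  have uL: "u s \<in> L" if "s < k" for s using that u by (auto simp: ordered_basis_def intro: span_base)
  have vL: "v s \<in> L" if "s < k" for s using that v by (auto simp: ordered_basis_def intro: span_base)
  have spu: "L = span (u ` {..<k})" using u by (simp add: ordered_basis_def)
  have sE: "subspace E" using \<eta> by (auto simp: ordered_basis_def)
  have "\<forall>j. \<exists>B. j < k \<longrightarrow> finite B \<and> independent B \<and> span B = W j \<and> card B = dim (W j)"
    using W(1) by (metis basis_subspace_exists)
  then obtain Bs where Bs: "\<And>j. j < k \<Longrightarrow> finite (Bs j)" "\<And>j. j < k \<Longrightarrow> independent (Bs j)"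
    "\<And>j. j < k \<Longrightarrow> span (Bs j) = W j" "\<And>j. j < k \<Longrightarrow> card (Bs j) = dim (W j)"
    by metis
  \<comment> \<open>The free parameters: one coefficient for each basis vector of each
    \<open>W j\<close>, so the cardinality of \<open>I\<close> is the sum of the dimensions.\<close>
  define I where "I = Sigma {..<k} Bs"
  have finI: "finite I" using Bs(1) by (auto simp: I_def)
  obtain c where c: "\<And>w. w \<in> L \<Longrightarrow> w = (\<Sum>j<k. scale (c w j) (v j))"
    using ordered_basis_expand[OF v] by blast
  obtain \<psi> where \<psi>: "\<And>t. t < N \<Longrightarrow> Vector_Spaces.linear scale (*) (\<psi> t)"
    "\<And>t t'. t < N \<Longrightarrow> t' < N \<Longrightarrow> \<psi> t (\<eta> t') = (if t = t' then 1 else 0)"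
    using ordered_basis_functionals[OF \<eta>] by metis
  have \<psi>_comb: "\<psi> t (\<Sum>t'<N. scale (f t') (\<eta> t')) = f t" if "t < N" for t f
  proof -
    interpret \<psi>: Vector_Spaces.linear scale "(*)" "\<psi> t" by (rule \<psi>(1)[OF that])
    have "\<psi> t (\<Sum>t'<N. scale (f t') (\<eta> t')) = (\<Sum>t'<N. f t' * (if t = t' then 1 else 0))"
      unfolding \<psi>.sum \<psi>.scale by (rule sum.cong) (use \<psi>(2)[OF that] in auto)
    then show ?thesis using that by (simp add: if_distrib cong: if_cong)
  qed
  have expand: "w = (\<Sum>t<N. scale (\<psi> t w) (\<eta> t))" if w: "w \<in> E" for w
  proof -
    obtain f where f: "w = (\<Sum>t<N. scale (f t) (\<eta> t))"
      using ordered_basis_expand[OF \<eta>] w by blast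
    also have "\<dots> = (\<Sum>t<N. scale (\<psi> t w) (\<eta> t))"
      by (rule sum.cong) (auto simp: f \<psi>_comb)
    finally show ?thesis .
  qed
  define z where "z g j = (\<Sum>b\<in>Bs j. scale (g (j, b)) b)" for g :: "nat \<times> 'b \<Rightarrow> 'a" and j
  have zW: "z g j \<in> W j" if "j < k" for g j
    unfolding z_def Bs(3)[OF that, symmetric] by (intro span_sum span_scale span_base)
  \<comment> \<open>The matrix, with respect to \<open>u\<close> and \<open>\<eta>\<close>, of the
    linear map that sends \<open>v j\<close> to \<open>z g j\<close>: expand \<open>u s\<close> in
    the basis \<open>v\<close> by \<open>c\<close>, then take coordinates in \<open>E\<close> by
    \<open>\<psi>\<close>.\<close>
  define G where "G g p = (if p \<in> V then \<psi> (snd p) (\<Sum>j<k. scale (c (u (fst p)) j) (z g j)) else 0)" for g p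
  have \<phi>_u: "\<phi> (u s) = (\<Sum>j<k. scale (c (u s) j) (\<phi> (v j)))"
    if "Vector_Spaces.linear scale scale \<phi>" "s < k" for \<phi> s
  proof -
    interpret \<phi>: Vector_Spaces.linear scale scale \<phi> by fact
    show ?thesis using arg_cong[OF c[OF uL[OF that(2)]], of \<phi>] by (simp add: \<phi>.sum \<phi>.scale)
  qed
  have G_row: "(\<Sum>t<N. scale (G g (s, t)) (\<eta> t)) = (\<Sum>j<k. scale (c (u s) j) (z g j))" if "s < k" for g s
  proof -
    have "(\<Sum>j<k. scale (c (u s) j) (z g j)) \<in> E"
      using zW W(2) by (intro subspace_sum subspace_scale sE) auto
    from expand[OF this] show ?thesis using that by (simp add: G_def V_def)
  qed
  \<comment> \<open>A map with matrix \<open>G g\<close> agrees on the basis \<open>u\<close> with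
    the map prescribed on \<open>v\<close>, hence on all of \<open>L\<close>. Parameters and
    matrices thus determine each other.\<close>
  have G_\<phi>: "\<phi> (v j) = z g j"
    if \<phi>: "Vector_Spaces.linear scale scale \<phi>" "\<And>s. s < k \<Longrightarrow> \<phi> (u s) = (\<Sum>t<N. scale (G g (s, t)) (\<eta> t))" and j: "j < k"
    for \<phi> g j
  proof -
    interpret pair: vector_space_pair scale scale by unfold_locales
    obtain \<phi>' where \<phi>': "Vector_Spaces.linear scale scale \<phi>'" "\<forall>j<k. \<phi>' (v j) = z g j"
      using ordered_basis_linear_extend[OF v] by blast
    have eq: "\<phi> (u s) = \<phi>' (u s)" if "s < k" for s
      using \<phi>(2)[OF that] G_row[OF that] \<phi>_u[OF \<phi>'(1) that] \<phi>'(2) by simp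
    have "\<phi> (v j) = \<phi>' (v j)"
    proof (rule pair.linear_eq_on_span[OF \<phi>(1) \<phi>'(1)])
      show "\<phi> x = \<phi>' x" if "x \<in> u ` {..<k}" for x using that eq by blast
      show "v j \<in> span (u ` {..<k})" using vL[OF j] spu by simp
    qed
    then show ?thesis using \<phi>'(2) j by simp
  qed
  have ex\<phi>: "\<exists>\<phi>. Vector_Spaces.linear scale scale \<phi> \<and> (\<forall>s<k. \<phi> (u s) = (\<Sum>t<N. scale (y (s, t)) (\<eta> t)))" for y
    by (rule ordered_basis_linear_extend[OF u])
  let ?S = "{g :: nat \<times> 'b \<Rightarrow> 'a. \<forall>p. p \<notin> I \<longrightarrow> g p = 0}"
  have "inj_on G ?S"
  proof (rule inj_onI)
    fix g g' assume g: "g \<in> ?S" "g' \<in> ?S" "G g = G g'"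
    obtain \<phi> where \<phi>: "Vector_Spaces.linear scale scale \<phi>" "\<forall>s<k. \<phi> (u s) = (\<Sum>t<N. scale (G g (s, t)) (\<eta> t))"
      using ex\<phi> by blast
    have "g (j, b) = g' (j, b)" if jb: "j < k" "b \<in> Bs j" for j b
    proof -
      have "z g j = z g' j" using G_\<phi>[OF \<phi>(1) _ jb(1), of g] G_\<phi>[OF \<phi>(1) _ jb(1), of g'] \<phi>(2) g(3) by simp
      then have "(\<Sum>b\<in>Bs j. scale (g (j, b) - g' (j, b)) b) = 0"
        by (simp add: z_def scale_left_diff_distrib sum_subtractf)
      then have "g (j, b) - g' (j, b) = 0"
        using Bs(2)[OF jb(1)] jb(2) unfolding independent_explicit
        by (auto dest!: spec[of _ "\<lambda>b. g (j, b) - g' (j, b)"])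
      then show ?thesis by simp
    qed
    moreover have "g p = g' p" if "p \<notin> I" for p using g(1,2) that by (cases p) simp
    ultimately show "g = g'" by (auto simp: fun_eq_iff I_def)
  qed
  moreover have "G ` ?S = Y"
  proof (intro equalityI subsetI)
    fix y assume "y \<in> G ` ?S"
    then obtain g where g: "y = G g" by blast
    obtain \<phi> where \<phi>: "Vector_Spaces.linear scale scale \<phi>" "\<forall>s<k. \<phi> (u s) = (\<Sum>t<N. scale (y (s, t)) (\<eta> t))"
      using ex\<phi> by blast
    have "\<phi> (v j) = z g j" if "j < k" for j using G_\<phi>[OF \<phi>(1) _ that] \<phi>(2) g by simp
    then show "y \<in> Y" using Y[OF \<phi>(1), of y] \<phi>(2) zW g by (simp add: G_def)
  next
    fix y assume y: "y \<in> Y"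
    obtain \<phi> where \<phi>: "Vector_Spaces.linear scale scale \<phi>" "\<forall>s<k. \<phi> (u s) = (\<Sum>t<N. scale (y (s, t)) (\<eta> t))"
      using ex\<phi> by blast
    have "\<phi> (v j) \<in> W j" if "j < k" for j using Y[OF \<phi>(1), of y] \<phi>(2) Y0[OF y] y that by blast
    then have "\<exists>f. \<phi> (v j) = (\<Sum>b\<in>Bs j. scale (f b) b)" if "j < k" for j
      using that Bs(1,3)[OF that] span_finite[of "Bs j"] by auto
    then obtain f where f: "\<And>j. j < k \<Longrightarrow> \<phi> (v j) = (\<Sum>b\<in>Bs j. scale (f j b) b)" by metis
    define g where "g = (\<lambda>(j, b). if (j, b) \<in> I then f j b else 0)"
    have z: "z g j = \<phi> (v j)" if "j < k" for j
      unfolding z_def f[OF that] by (rule sum.cong) (use that in \<open>auto simp: g_def I_def\<close>)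
    have "G g p = y p" for p
    proof (cases "p \<in> V")
      case True
      then obtain s t where p: "p = (s, t)" "s < k" "t < N" by (auto simp: V_def)
      have "(\<Sum>j<k. scale (c (u s) j) (z g j)) = \<phi> (u s)"
        using \<phi>_u[OF \<phi>(1) p(2)] z by simp
      then show ?thesis using True p \<phi>(2) \<psi>_comb[OF p(3)] by (simp add: G_def)
    next
      case False
      then show ?thesis using Y0[OF y] by (simp add: G_def)
    qed
    then have "y = G g" by auto
    moreover have "g \<in> ?S" by (auto simp: g_def)
    ultimately show "y \<in> G ` ?S" by blast
  qed
  moreover have "function_space_dim (G ` ?S) = function_space_dim ?S"
  proof (rule function_space_dim_image_inj)
    have zadd: "z (\<lambda>p. g p + h p) j = z g j + z h j" and zscale: "z (\<lambda>p. a * g p) j = scale a (z g j)" for g h a j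
      by (simp_all add: z_def scale_left_distrib sum.distrib scale_sum_right)
    show "G (\<lambda>p. g p + h p) = (\<lambda>p. G g p + G h p)" for g h
    proof
      fix p
      show "G (\<lambda>p. g p + h p) p = G g p + G h p"
      proof (cases "p \<in> V")
        case True
        then interpret \<psi>: Vector_Spaces.linear scale "(*)" "\<psi> (snd p)" by (intro \<psi>(1)) (auto simp: V_def)
        show ?thesis by (simp add: G_def zadd scale_right_distrib sum.distrib \<psi>.add)
      qed (simp add: G_def)
    qed
    show "G (\<lambda>p. a * g p) = (\<lambda>p. a * G g p)" for a g
    proof
      fix p
      show "G (\<lambda>p. a * g p) p = a * G g p"
      proof (cases "p \<in> V")
        case True
        then interpret \<psi>: Vector_Spaces.linear scale "(*)" "\<psi> (snd p)" by (intro \<psi>(1)) (auto simp: V_def)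
        have "(\<Sum>j<k. scale (c (u (fst p)) j) (z (\<lambda>p. a * g p) j)) = scale a (\<Sum>j<k. scale (c (u (fst p)) j) (z g j))"
          by (simp add: zscale scale_sum_right mult.commute)
        then show ?thesis by (simp add: G_def \<psi>.scale)
      qed (simp add: G_def)
    qed
    interpret fs: vector_space "\<lambda>c (l::nat \<times> 'b \<Rightarrow> 'a) p. c * l p" by (rule vector_space_fun)
    show "fs.subspace ?S" by (auto simp: fs.subspace_def)
  qed fact
  ultimately have "function_space_dim Y = card I"
    using function_space_dim_support[OF finI, where 'k = 'a] by simp
  also have "\<dots> = (\<Sum>j<k. dim (W j))" using Bs(1,4) by (simp add: I_def card_SigmaI)
  finally show ?thesis .
qed

lemma ordered_basisI_dim:
  assumes "span (v ` {..<n}) = W" "dim W = n"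
  shows "ordered_basis n W v"
proof -
  have le: "card (v ` {..<n}) \<le> n" using card_image_le[of "{..<n}" v] by simp
  have "dim W \<le> card (v ` {..<n})" using assms by (intro dim_le_card) auto
  then have card: "card (v ` {..<n}) = n" using le assms(2) by simp
  then have "inj_on v {..<n}" by (intro eq_card_imp_inj_on) auto
  moreover have "independent (v ` {..<n})"
    using assms card by (intro card_le_dim_spanning[of _ W]) (auto intro: span_base)
  ultimately show ?thesis using assms(1) by (simp add: ordered_basis_def)
qed

lemma dim_Int_of_span_UNIV:
  assumes A: "subspace A" and E: "subspace E" and span: "span (A \<union> E) = UNIV"
  shows "dim (A \<inter> E) + dim UNIV = dim A + dim E"
proof -
  have "dim (A \<union> E) = dim UNIV" using span by (metis dim_span)
  then show ?thesis using dim_Un_Int[OF A E] by (simp add: add.commute)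
qed

text \<open>The modular law is applied to the two spaces \<open>S + L\<close> and
  \<open>T + L\<close>, whereas the theorem speaks of a threefold sum in which \<open>L\<close>
  occurs once.\<close>

lemma span_Un_Un_eq_sums:
  assumes "subspace S" "subspace T" "subspace L"
  shows "span (span (S \<union> L) \<union> span (T \<union> L)) = {p + q + l |p q l. p \<in> S \<and> q \<in> T \<and> l \<in> L}" (is "_ = ?X")
proof (intro equalityI subsetI)
  have "?X = {x + l |x l. x \<in> {p + q |p q. p \<in> S \<and> q \<in> T} \<and> l \<in> L}" by blast
  then have X: "subspace ?X" by (simp only: subspace_sums assms)
  have 0: "0 \<in> S" "0 \<in> T" "0 \<in> L" using assms by (auto intro: subspace_0)
  have "S \<subseteq> ?X" "T \<subseteq> ?X" "L \<subseteq> ?X"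
    using 0 by (metis (mono_tags, lifting) CollectI add_0 add_0_right subsetI)+
  then have "span (S \<union> L) \<union> span (T \<union> L) \<subseteq> ?X"
    by (intro Un_least span_minimal X) auto
  then show "x \<in> ?X" if "x \<in> span (span (S \<union> L) \<union> span (T \<union> L))" for x
    using that span_minimal[OF _ X] by blast
next
  fix x assume "x \<in> ?X"
  then obtain p q l where x: "x = p + q + l" "p \<in> S" "q \<in> T" "l \<in> L" by blast
  have "p \<in> span (S \<union> L)" "q \<in> span (T \<union> L)" "l \<in> span (S \<union> L)"
    using x by (auto intro: span_base)
  then show "x \<in> span (span (S \<union> L) \<union> span (T \<union> L))"
    unfolding x(1) by (intro span_add) (auto intro: span_base)
qed

end

theorem theorem2p10:
  fixes scale :: "'k::alg_closed_field \<Rightarrow> 'h::ab_group_add \<Rightarrow> 'h"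
    and B :: "'h set" and d r :: nat
    and P Q :: "nat \<Rightarrow> 'h set" and a b :: "nat \<Rightarrow> nat"
    and L :: "'h set" and \<sigma> m n :: "nat \<Rightarrow> nat"
    and e :: "nat \<Rightarrow> 'h" and x :: "nat \<times> nat \<Rightarrow> 'k"
  assumes "finite_dimensional_vector_space scale B"
    and "vector_space.dim scale UNIV = d"
    and "vector_space.complete_flag scale d UNIV P"
    and "vector_space.complete_flag scale d UNIV Q"
    and "strict_mono_on {..r} a" and "a r < d"
    and "strict_mono_on {..r} b" and "b r < d"
    and "L \<in> vector_space.open_schubert_points scale r P a"
    and "L \<in> vector_space.open_schubert_points scale r Q b"
    and "vector_space.flag_permutation scale (r + 1) L
           (vector_space.induced_flag scale L P) (vector_space.induced_flag scale L Q) \<sigma>"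
    and "\<And>j. j \<le> r \<Longrightarrow> m j = a (last_active a j)"
    and "\<And>j. j \<le> r \<Longrightarrow> n j = b (last_active b (\<sigma> j))"
    and "vector_space.ordered_basis scale d UNIV e"
    and "L = vector_space.chart_point scale r d e x"
  shows "int (function_space_dim
           (vector_space.schubert_intersection_tangent_space scale r d e P a Q b x)) =
         (int r + 1) * (int d - int r - 1)
           - (\<Sum>i\<le>r. int (a i) - int i) - (\<Sum>i\<le>r. int (b i) - int i)
           + (\<Sum>j\<le>r. int (vector_space.codim scale
                {p + q + l |p q l. p \<in> P (m j) \<and> q \<in> Q (n j) \<and> l \<in> L}))"
proof -
  interpret finite_dimensional_vector_space scale B by fact
  note d = assms(2) and P = assms(3) and Q = assms(4) and a = assms(5,6) and b = assms(7,8)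
    and LP = assms(9) and LQ = assms(10) and m = assms(12) and n = assms(13) and e = assms(14)
    and L_chart = assms(15)
  \<comment> \<open>\<open>E\<close> is the complement of \<open>L\<close> fixed by the chart and
    serves as a model of the quotient by \<open>L\<close>; \<open>N\<close> is its
    dimension.\<close>
  define N where "N = d - (r + 1)"
  define \<eta> where "\<eta> t = e (r + 1 + t)" for t
  define E where "E = span (\<eta> ` {..<N})"
  let ?V = "chart_vars r d" and ?u = "chart_vec r d e x"
  have LP': "L \<in> schubert_points r P a" and LQ': "L \<in> schubert_points r Q b"
    using LP LQ by (auto simp: open_schubert_points_def)
  have L: "subspace L" "dim L = r + 1"
    using LP' by (auto simp: schubert_points_def grassmannian_def)
  have rd: "r + 1 \<le> d" using strict_mono_on_le_last(2)[OF a, of r] a(2) by simp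
  have V: "?V = {..<r + 1} \<times> {..<N}"
    by (simp add: chart_vars_def N_def lessThan_Suc_atMost)
  have u: "ordered_basis (r + 1) L ?u"
    using L(2) by (intro ordered_basisI_dim) (simp_all add: L_chart chart_point_eq_span lessThan_Suc_atMost)
  have e': "inj_on e {..<d}" "independent (e ` {..<d})" "span (e ` {..<d}) = UNIV"
    using e by (auto simp: ordered_basis_def)
  have "\<eta> ` {..<N} \<subseteq> e ` {..<d}" using rd by (auto simp: \<eta>_def N_def)
  then have "independent (\<eta> ` {..<N})" using e'(2) by (rule independent_mono[rotated])
  moreover have "inj_on \<eta> {..<N}"
    by (rule inj_onI) (use inj_onD[OF e'(1)] in \<open>fastforce simp: \<eta>_def N_def\<close>)
  ultimately have \<eta>: "ordered_basis N E \<eta>" by (simp add: ordered_basis_def E_def)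
  then have dimE: "dim E = N"
    using dim_span_eq_card_independent[of "\<eta> ` {..<N}"] by (simp add: ordered_basis_def card_image)
  have sE: "subspace E" by (simp add: E_def)
  have dir: "chart_dir r d e y s = (\<Sum>t<N. scale (y (s, t)) (\<eta> t))" for y s
    by (simp add: chart_dir_def \<eta>_def N_def)
  \<comment> \<open>The first \<open>r + 1\<close> vectors of \<open>e\<close> differ from the chart
    vectors of \<open>L\<close> by elements of \<open>E\<close>, and the remaining ones lie in
    \<open>E\<close>.\<close>
  have LE: "span (L \<union> E) = UNIV"
  proof -
    have "e s \<in> span (L \<union> E)" if "s < d" for s
    proof (cases "s \<le> r")
      case True
      have "?u s \<in> L" using True by (auto simp: L_chart chart_point_eq_span intro: span_base)
      moreover have "(\<Sum>t<N. scale (x (s, t)) (\<eta> t)) \<in> E"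
        unfolding E_def by (intro span_sum span_scale span_base) auto
      ultimately have "?u s - (\<Sum>t<N. scale (x (s, t)) (\<eta> t)) \<in> span (L \<union> E)"
        by (intro span_diff) (auto intro: span_base)
      then show ?thesis by (simp add: chart_vec_def \<eta>_def N_def)
    next
      case False
      then have "e s = \<eta> (s - (r + 1))" "s - (r + 1) < N" using that by (auto simp: \<eta>_def N_def)
      then have "e s \<in> E" by (auto simp: E_def intro: span_base)
      then show ?thesis by (simp add: span_base)
    qed
    then have "span (e ` {..<d}) \<subseteq> span (L \<union> E)" by (intro span_minimal) auto
    then show ?thesis unfolding e'(3) by blast
  qed
  obtain v where \<sigma>: "\<sigma> permutes {..<r + 1}" and v: "ordered_basis (r + 1) L v"
    and vP: "\<And>i. i < r + 1 \<Longrightarrow> v i \<in> induced_flag L P i"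
    and vQ: "\<And>i. i < r + 1 \<Longrightarrow> v i \<in> induced_flag L Q (\<sigma> i)"
    using assms(11) unfolding flag_permutation_def by blast
  let ?\<tau> = "inv_into UNIV \<sigma>"
  \<comment> \<open>The same basis, relabelled so that its \<open>i\<close>-th vector lies in the
    \<open>i\<close>-th step of the flag induced by \<open>Q\<close>. The result on one flag then
    applies to \<open>Q\<close> as well.\<close>
  define v' where "v' = v \<circ> ?\<tau>"
  have \<sigma>': "?\<tau> permutes {..<r + 1}" by (rule permutes_inv[OF \<sigma>])
  have v': "ordered_basis (r + 1) L v'"
  proof -
    have img: "v' ` {..<r + 1} = v ` {..<r + 1}"
      unfolding v'_def image_comp[symmetric] permutes_image[OF \<sigma>'] ..
    moreover have "inj_on v' {..<r + 1}"
      unfolding v'_def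
      using v by (intro comp_inj_on permutes_inj_on[OF \<sigma>']) (simp only: ordered_basis_def permutes_image[OF \<sigma>'])
    ultimately show ?thesis using v unfolding ordered_basis_def by metis
  qed
  have v'Q: "v' i \<in> induced_flag L Q i" if "i < r + 1" for i
    using vQ[of "?\<tau> i"] permutes_in_image[OF \<sigma>', of i] permutes_inverses(1)[OF \<sigma>] that
    by (simp add: v'_def)
  have \<sigma>_le: "\<sigma> j \<le> r \<longleftrightarrow> j \<le> r" for j
    using permutes_in_image[OF \<sigma>, of j] by (simp add: less_Suc_eq_le)
  define S T where "S j = span (P (m j) \<union> L)" and "T j = span (Q (n j) \<union> L)" for j
  \<comment> \<open>\<open>S j\<close> and \<open>T j\<close> contain \<open>L\<close>, so
    intersecting with the complement \<open>E\<close> picks one representative of each class modulo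
    \<open>L\<close>.\<close>
  define W where "W j = S j \<inter> T j \<inter> E" for j
  define Y where "Y = {y. (\<forall>p. p \<notin> ?V \<longrightarrow> y p = 0) \<and>
    (\<forall>f\<in>schubert_minors r d e P a \<union> schubert_minors r d e Q b. dir_deriv x y f = 0)}"
  have minors_ideal: "schubert_minors r d e P a \<subseteq> point_ideal ?V x" "schubert_minors r d e Q b \<subseteq> point_ideal ?V x"
    using schubert_minors_subset_point_ideal[OF P a] schubert_minors_subset_point_ideal[OF Q b] LP' LQ'
    unfolding L_chart by blast+
  have "function_space_dim (schubert_intersection_tangent_space r d e P a Q b x) = function_space_dim Y"
  proof -
    let ?T = "schubert_intersection_tangent_space r d e P a Q b x"
    interpret fs: vector_space "\<lambda>c (l::(nat \<times> nat, 'k) mv_poly \<Rightarrow> 'k) p. c * l p" by (rule vector_space_fun)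
    have "fs.subspace ?T"
      unfolding fs.subspace_def schubert_intersection_tangent_space_def zariski_tangent_space_def Let_def
      by (auto simp: algebra_simps)
    then have "function_space_dim (tangent_coords ?V x ` ?T) = function_space_dim ?T"
      using inj_on_tangent_coords[OF minors_ideal]
      by (intro function_space_dim_image_inj)
        (auto simp: tangent_coords_def schubert_intersection_tangent_space_def schubert_ideal_def)
    then show ?thesis
      using tangent_coords_image[OF minors_ideal]
      by (simp add: Y_def schubert_intersection_tangent_space_def schubert_ideal_def)
  qed
  \<comment> \<open>Tangent vectors are matrices in the chart basis
    \<open>chart_vec r d e x\<close>; the constraints are read in the adapted basis
    \<open>v\<close>.\<close>
  also have "function_space_dim Y = (\<Sum>j<r + 1. dim (W j))"
  proof (rule function_space_dim_constrained_maps[OF u v \<eta>])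
    show "subspace (W j)" "W j \<subseteq> E" for j
      using sE by (auto simp: W_def S_def T_def intro: subspace_inter)
    show "y p = 0" if "y \<in> Y" "p \<notin> {..<r + 1} \<times> {..<N}" for y p
      using that unfolding Y_def V by blast
    fix y \<phi>
    assume \<phi>: "Vector_Spaces.linear scale scale \<phi>"
      "\<And>s. s < r + 1 \<Longrightarrow> \<phi> (?u s) = (\<Sum>t<N. scale (y (s, t)) (\<eta> t))"
      and supp: "\<And>p. p \<notin> {..<r + 1} \<times> {..<N} \<Longrightarrow> y p = 0"
    interpret \<phi>: Vector_Spaces.linear scale scale \<phi> by (rule \<phi>(1))
    have dir': "\<phi> (?u s) = chart_dir r d e y s" if "s \<le> r" for s
      using \<phi>(2)[of s] that by (simp add: dir)
    have "\<phi> w \<in> E" if "w \<in> span (?u ` {..<r + 1})" for w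
      using that
    proof (rule span_induct)
      show "subspace {w. \<phi> w \<in> E}"
        by (rule subspaceI) (auto simp: \<phi>.zero \<phi>.add \<phi>.scale subspace_0 subspace_add subspace_scale sE)
      fix w assume "w \<in> ?u ` {..<r + 1}"
      then obtain s where "\<phi> w = (\<Sum>t<N. scale (y (s, t)) (\<eta> t))" using \<phi>(2) by auto
      then show "\<phi> w \<in> E"
        unfolding E_def by (simp only:) (intro span_sum span_scale span_base imageI)
    qed
    moreover have "v j \<in> span (?u ` {..<r + 1})" if "j \<le> r" for j
    proof -
      have "v j \<in> span (v ` {..<r + 1})" using that by (intro span_base) simp
      then show ?thesis using u v unfolding ordered_basis_def by blast
    qed
    ultimately have E: "\<phi> (v j) \<in> E" if "j \<le> r" for j using that by blast
    have "y \<in> Y \<longleftrightarrow> (\<forall>f\<in>schubert_minors r d e P a. dir_deriv x y f = 0) \<and>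
        (\<forall>f\<in>schubert_minors r d e Q b. dir_deriv x y f = 0)"
      using supp unfolding Y_def V by blast
    also have "\<dots> \<longleftrightarrow> (\<forall>j\<le>r. \<phi> (v j) \<in> span (P (a (last_active a j)) \<union> L)) \<and>
        (\<forall>i\<le>r. \<phi> (v' i) \<in> span (Q (b (last_active b i)) \<union> L))"
      by (simp only: dir_deriv_schubert_minors_iff[OF P a LP' L_chart \<phi>(1) dir']
        dir_deriv_schubert_minors_iff[OF Q b LQ' L_chart \<phi>(1) dir']
        flag_conditions_iff[OF P d a LP v vP \<phi>(1)] flag_conditions_iff[OF Q d b LQ v' v'Q \<phi>(1)])
    also have "(\<forall>i\<le>r. \<phi> (v' i) \<in> span (Q (b (last_active b i)) \<union> L)) \<longleftrightarrow>
        (\<forall>j\<le>r. \<phi> (v j) \<in> span (Q (b (last_active b (\<sigma> j))) \<union> L))"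
    proof -
      \<comment> \<open>Put \<open>i = \<sigma> j\<close>: since
        \<open>v' (\<sigma> j) = v j\<close>, both flags now constrain the same vector.\<close>
      have "(\<forall>i\<in>\<sigma> ` {..<r + 1}. \<phi> (v' i) \<in> span (Q (b (last_active b i)) \<union> L)) \<longleftrightarrow>
          (\<forall>j\<in>{..<r + 1}. \<phi> (v j) \<in> span (Q (b (last_active b (\<sigma> j))) \<union> L))"
        by (simp add: v'_def permutes_inverses(2)[OF \<sigma>])
      then show ?thesis
        unfolding permutes_image[OF \<sigma>] by (simp add: Ball_def less_Suc_eq_le)
    qed
    also have "(\<forall>j\<le>r. \<phi> (v j) \<in> span (P (a (last_active a j)) \<union> L)) \<and>
        (\<forall>j\<le>r. \<phi> (v j) \<in> span (Q (b (last_active b (\<sigma> j))) \<union> L)) \<longleftrightarrow> (\<forall>j<r + 1. \<phi> (v j) \<in> W j)"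
      using E by (auto simp: W_def S_def T_def m n less_Suc_eq_le)
    finally show "y \<in> Y \<longleftrightarrow> (\<forall>j<r + 1. \<phi> (v j) \<in> W j)" .
  qed
  also have "int (\<Sum>j<r + 1. dim (W j)) = (\<Sum>j\<le>r. int (dim (W j)))"
    by (simp add: lessThan_Suc_atMost)
  \<comment> \<open>Here \<open>dim (W j)\<close> is
    \<open>dim (S j \<inter> T j) - (r + 1)\<close>, and the modular law expresses the intersection
    by \<open>dim (S j) = d + j - a j\<close>,
    \<open>dim (T j) = d + \<sigma> j - b (\<sigma> j)\<close> and the codimension of
    \<open>S j + T j\<close>.\<close>
  also have "\<dots> = (\<Sum>j\<le>r. (int d - int r - 1) - (int (a j) - int j) - (int (b (\<sigma> j)) - int (\<sigma> j))
      + int (codim {p + q + l |p q l. p \<in> P (m j) \<and> q \<in> Q (n j) \<and> l \<in> L}))"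
  proof (rule sum.cong[OF refl])
    fix j assume "j \<in> {..r}"
    then have j: "j \<le> r" by simp
    let ?X = "{p + q + l |p q l. p \<in> P (m j) \<and> q \<in> Q (n j) \<and> l \<in> L}"
    have sub: "subspace (S j)" "subspace (T j)" by (simp_all add: S_def T_def)
    have m_le: "m j \<le> d" "n j \<le> d"
      using m[OF j] n[OF j] strict_mono_on_le_last(1)[OF a] strict_mono_on_le_last(1)[OF b]
        last_active_le[of a j] last_active_le[of b "\<sigma> j"] \<sigma>_le[of j] j by auto
    have dimS: "dim (S j) + a j = d + j"
      using dim_Un_last_active[OF P LP a j] by (simp add: S_def m[OF j])
    have dimT: "dim (T j) + b (\<sigma> j) = d + \<sigma> j"
      using dim_Un_last_active[OF Q LQ b, of "\<sigma> j"] \<sigma>_le[of j] j by (simp add: T_def n[OF j])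
    have "span (S j \<union> T j) = ?X"
      unfolding S_def T_def using m_le L(1)
      by (intro span_Un_Un_eq_sums complete_flag_subspace[OF P] complete_flag_subspace[OF Q])
    then have "dim (S j \<union> T j) = dim ?X" by (metis dim_span)
    moreover have "dim ?X \<le> d" using dim_subset_UNIV dim_subset[of ?X UNIV] d by simp
    ultimately have codim: "int (codim ?X) = int d - int (dim (S j \<union> T j))"
      unfolding codim_def d by simp
    \<comment> \<open>As \<open>L + E\<close> is everything and \<open>S j \<inter> T j\<close>
      contains \<open>L\<close>, the intersection with \<open>E\<close> has the expected
      dimension.\<close>
    have "L \<subseteq> S j \<inter> T j" by (auto simp: S_def T_def intro: span_base)
    then have "span (L \<union> E) \<subseteq> span (S j \<inter> T j \<union> E)" by (intro span_mono) auto
    then have "span (S j \<inter> T j \<union> E) = UNIV" using LE by auto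
    then have "dim (W j) + d = dim (S j \<inter> T j) + N"
      using dim_Int_of_span_UNIV[of "S j \<inter> T j" E] sub sE d dimE by (simp add: W_def subspace_inter)
    then show "int (dim (W j)) = (int d - int r - 1) - (int (a j) - int j) - (int (b (\<sigma> j)) - int (\<sigma> j)) + int (codim ?X)"
      using dim_Un_Int[OF sub] dimS dimT codim rd unfolding N_def by linarith
  qed
  also have "\<dots> = (int r + 1) * (int d - int r - 1)
      - (\<Sum>j\<le>r. int (a j) - int j) - (\<Sum>j\<le>r. int (b (\<sigma> j)) - int (\<sigma> j))
      + (\<Sum>j\<le>r. int (codim {p + q + l |p q l. p \<in> P (m j) \<and> q \<in> Q (n j) \<and> l \<in> L}))"
    by (simp only: sum.distrib sum_subtractf sum_constant card_atMost) (simp add: algebra_simps)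
  also have "(\<Sum>j\<le>r. int (b (\<sigma> j)) - int (\<sigma> j)) = (\<Sum>j\<le>r. int (b j) - int j)"
    using sum.permute[OF \<sigma>, of "\<lambda>j. int (b j) - int j"] by (simp add: lessThan_Suc_atMost)
  finally show ?thesis .
qed

end
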